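(* Let $(G,d,\lambda)$ be as in the context and let $\mathcal{F}=\{f_x\}_{x\in G}$ be a continuous frame in $\mathcal{H}$ with canonical dual frame $\{\tilde f_x\}_{x\in G}$ such that $$\langle \tilde f_x,f_y\rangle=\langle \tilde f_{zx},f_{zy}\rangle\quad\text{for all } x,y,z\in G.$$ Assume that the Berezin transform $B:\mathcal{B}(\mathcal{H})\to C(G)$, $B(T)(x)=\langle T\tilde f_x,f_x\rangle$, is injective. Let $T:\mathcal{H}\to\mathcal{H}$ be a bounded linear operator which, for some positive measurable $p:G\to(0,\infty)$, is $p$-weakly localized with respect to the pair $(\tilde{\mathcal{F}},\mathcal{F})$. Then $T$ is compact if and only if $\lim_{d(x,e)\to\infty}B(T)(x)=0$, where $e$ is the identity element of $G$.
   Context: $\mathcal{H}$ is a separable Hilbert space and $\mathcal{B}(\mathcal{H})$ the bounded linear operators on it. $G$ is a second countable locally compact topological group; $d$ is a left-invariant metric on $G$ ($d(zx,zy)=d(x,y)$) which is proper (closed bounded sets are compact) and generates the topology of $G$; $\lambda$ is a fixed left Haar measure. It is assumed that $(G,d)$ is a geodesic metric space with finite asymptotic dimension, meaning: there is an integer $N>0$ such that for any $r>0$ there is a covering $\mathcal{D}_r=\{F_j\}$ of $G$ by disjoint Borel sets such that (i) every point of $G$ belongs to at most $N$ of the sets $G_j:=\{x\in G: d(x,F_j)\le r\}$, and (ii) there exists $K>0$ with $\operatorname{diam}F_j\le Kr$ for every $j$. $D(x,r)$ is the closed ball of radius $r$ about $x$, and $D(x,r)^c$ its complement. Continuous frame: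 a family $\{f_x\}_{x\in G}\subset\mathcal{H}$ such that $x\mapsto f_x$ is bounded and continuous and there are constants $c,C>0$ with $c\|f\|^2\le\int_G|\langle f,f_x\rangle|^2d\lambda(x)\le C\|f\|^2$ for all $f\in\mathcal{H}$. Its canonical dual is $\tilde{\mathcal{F}}=\{\tilde f_x\}$, $\tilde f_x=S^{-1}f_x$, where $Sf=\int_G\langle f,f_x\rangle f_x\,d\lambda(x)$ (weak integral). A linear operator $T:\mathcal{H}\to\mathcal{H}$ is $p$-weakly localized with respect to $(\tilde{\mathcal{F}},\mathcal{F})$ if there is a constant $M$ with $\int_G|\langle T\tilde f_x,f_y\rangle|p(y)d\lambda(y)\le Mp(x)$ for all $x$ and $\int_G|\langle T\tilde f_x,f_y\rangle|p(x)d\lambda(x)\le Mp(y)$ for all $y$, and $$\lim_{R\to\infty}\sup_{x\in G}\frac1{p(x)}\int_{D(x,R)^c}|\langle T\tilde f_x,f_y\rangle|p(y)d\lambda(y)=0,\quad \lim_{R\to\infty}\sup_{y\in G}\frac1{p(y)}\int_{D(y,R)^c}|\langle T\tilde f_x,f_y\rangle|p(x)d\lambda(x)=0.$$ *)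

theory Defs
  imports "HOL-Analysis.Analysis"
begin

section \<open>Complex Hilbert spaces\<close>

class complex_vector = real_vector +
  fixes scaleC :: "complex \<Rightarrow> 'a \<Rightarrow> 'a" (infixr "*\<^sub>C" 75)
  assumes scaleC_add_right: "a *\<^sub>C (x + y) = a *\<^sub>C x + a *\<^sub>C y"
    and scaleC_add_left: "(a + b) *\<^sub>C x = a *\<^sub>C x + b *\<^sub>C x"
    and scaleC_scaleC: "a *\<^sub>C b *\<^sub>C x = (a * b) *\<^sub>C x"
    and scaleC_one: "1 *\<^sub>C x = x"
    and scaleR_scaleC: "r *\<^sub>R x = complex_of_real r *\<^sub>C x"

text \<open>The inner product is linear in its first argument.\<close>

class complex_inner = complex_vector + real_normed_vector +
  fixes cinner :: "'a \<Rightarrow> 'a \<Rightarrow> complex"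
  assumes cinner_commute: "cinner x y = cnj (cinner y x)"
    and cinner_add_left: "cinner (x + y) z = cinner x z + cinner y z"
    and cinner_scaleC_left: "cinner (c *\<^sub>C x) y = c * cinner x y"
    and cinner_ge_zero: "0 \<le> Re (cinner x x)"
    and norm_eq_sqrt_cinner: "norm x = sqrt (Re (cinner x x))"

text \<open>Separable Hilbert spaces are of sort \<open>{chilbert_space, second_countable_topology}\<close>:
  a metric space is separable iff it is second countable.\<close>

class chilbert_space = complex_inner + complete_space

text \<open>The bounded (complex-)linear operators; \<open>bounded_linear\<close> alone only gives real linearity.\<close>

definition bounded_operators :: "('h::complex_inner \<Rightarrow> 'h) set" where
  "bounded_operators = {T. bounded_linear T \<and> (\<forall>c x. T (c *\<^sub>C x) = c *\<^sub>C T x)}"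

definition compact_operator :: "('h::complex_inner \<Rightarrow> 'h) \<Rightarrow> bool" where
  "compact_operator T \<longleftrightarrow> T \<in> bounded_operators \<and> compact (closure (T ` cball 0 1))"


section \<open>The group\<close>

text \<open>
  The group is a type of class \<open>topological_group_add\<close>: it is written additively but need not be
  commutative, and its identity is \<open>0\<close>. Its metric is the one of class \<open>metric_space\<close>,
  so it generates the topology of the group.
\<close>

definition left_invariant_metric :: "'g::{group_add, metric_space} itself \<Rightarrow> bool" where
  "left_invariant_metric _ \<longleftrightarrow> (\<forall>x y z :: 'g. dist (z + x) (z + y) = dist x y)"

definition proper_metric :: "'g::metric_space itself \<Rightarrow> bool" where
  "proper_metric _ \<longleftrightarrow> (\<forall>A :: 'g set. closed A \<and> bounded A \<longrightarrow> compact A)"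

definition geodesic_metric :: "'g::metric_space itself \<Rightarrow> bool" where
  "geodesic_metric _ \<longleftrightarrow> (\<forall>x y :: 'g. \<exists>\<gamma> :: real \<Rightarrow> 'g.
     \<gamma> 0 = x \<and> \<gamma> (dist x y) = y \<and>
     (\<forall>s\<in>{0..dist x y}. \<forall>t\<in>{0..dist x y}. dist (\<gamma> s) (\<gamma> t) = \<bar>s - t\<bar>))"

text \<open>
  \<open>partition_on\<close> excludes an empty member, for which \<open>infdist\<close> would have the junk value
  \<open>0\<close>. Finiteness and boundedness are stated explicitly because \<open>card\<close> of an infinite
  set and \<open>diameter\<close> of an unbounded one are junk values. The constant \<open>K\<close> may depend on \<open>r\<close>.
\<close>

definition finite_asymptotic_dimension :: "'g::metric_space itself \<Rightarrow> bool" where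
  "finite_asymptotic_dimension _ \<longleftrightarrow> (\<exists>N::nat. N > 0 \<and> (\<forall>r::real. r > 0 \<longrightarrow>
     (\<exists>\<D> :: 'g set set.
        partition_on UNIV \<D> \<and> \<D> \<subseteq> sets borel \<and>
        (\<forall>x. finite {F \<in> \<D>. infdist x F \<le> r} \<and> card {F \<in> \<D>. infdist x F \<le> r} \<le> N) \<and>
        (\<exists>K::real. K > 0 \<and> (\<forall>F\<in>\<D>. bounded F \<and> diameter F \<le> K * r)))))"

text \<open>
  Inner and outer regularity are not listed: they are automatic for a Borel measure that is finite
  on compact sets of a second countable locally compact Hausdorff space.
\<close>

definition left_haar_measure :: "'g::{topological_group_add, t2_space} measure \<Rightarrow> bool" where
  "left_haar_measure \<mu> \<longleftrightarrow>
     sets \<mu> = sets borel \<and>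
     emeasure \<mu> UNIV \<noteq> 0 \<and>
     (\<forall>C. compact C \<longrightarrow> emeasure \<mu> C < \<infinity>) \<and>
     (\<forall>z. \<forall>A\<in>sets borel. emeasure \<mu> ((\<lambda>x. z + x) ` A) = emeasure \<mu> A)"


section \<open>Continuous frames\<close>

definition continuous_frame ::
    "'g::topological_space measure \<Rightarrow> ('g \<Rightarrow> 'h::complex_inner) \<Rightarrow> bool" where
  "continuous_frame \<mu> f \<longleftrightarrow>
     bounded (range f) \<and> continuous_on UNIV f \<and>
     (\<exists>c>0. \<exists>C>0. \<forall>v.
        ennreal (c * (norm v)\<^sup>2) \<le> (\<integral>\<^sup>+x. ennreal ((cmod (cinner v (f x)))\<^sup>2) \<partial>\<mu>) \<and>
        (\<integral>\<^sup>+x. ennreal ((cmod (cinner v (f x)))\<^sup>2) \<partial>\<mu>) \<le> ennreal (C * (norm v)\<^sup>2))"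

text \<open>The weak integral \<open>\<integral> \<langle>v, f x\<rangle> f x d\<mu>\<close>: the vector representing
  \<open>w \<mapsto> \<integral> \<langle>v, f x\<rangle> \<langle>f x, w\<rangle> d\<mu>\<close>.\<close>

definition frame_operator ::
    "'g measure \<Rightarrow> ('g \<Rightarrow> 'h::complex_inner) \<Rightarrow> 'h \<Rightarrow> 'h" where
  "frame_operator \<mu> f v =
     (THE u. \<forall>w. cinner u w = (\<integral>x. cinner v (f x) * cinner (f x) w \<partial>\<mu>))"

definition canonical_dual ::
    "'g measure \<Rightarrow> ('g \<Rightarrow> 'h::complex_inner) \<Rightarrow> 'g \<Rightarrow> 'h" where
  "canonical_dual \<mu> f x = inv (frame_operator \<mu> f) (f x)"

definition berezin ::
    "'g measure \<Rightarrow> ('g \<Rightarrow> 'h::complex_inner) \<Rightarrow> ('h \<Rightarrow> 'h) \<Rightarrow> 'g \<Rightarrow> complex" where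
  "berezin \<mu> f T x = cinner (T (canonical_dual \<mu> f x)) (f x)"

definition weakly_localized ::
    "'g::metric_space measure \<Rightarrow> ('g \<Rightarrow> real) \<Rightarrow> ('g \<Rightarrow> 'h::complex_inner) \<Rightarrow> ('g \<Rightarrow> 'h) \<Rightarrow>
     ('h \<Rightarrow> 'h) \<Rightarrow> bool" where
  "weakly_localized \<mu> p f' f T \<longleftrightarrow>
     (\<exists>M::real.
        (\<forall>x. (\<integral>\<^sup>+y. ennreal (cmod (cinner (T (f' x)) (f y)) * p y) \<partial>\<mu>) \<le> ennreal (M * p x)) \<and>
        (\<forall>y. (\<integral>\<^sup>+x. ennreal (cmod (cinner (T (f' x)) (f y)) * p x) \<partial>\<mu>) \<le> ennreal (M * p y))) \<and>
     ((\<lambda>R::real. SUP x. ennreal (1 / p x) *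
        (\<integral>\<^sup>+y\<in>- cball x R. ennreal (cmod (cinner (T (f' x)) (f y)) * p y) \<partial>\<mu>)) \<longlongrightarrow> 0) at_top \<and>
     ((\<lambda>R::real. SUP y. ennreal (1 / p y) *
        (\<integral>\<^sup>+x\<in>- cball y R. ennreal (cmod (cinner (T (f' x)) (f y)) * p x) \<partial>\<mu>)) \<longlongrightarrow> 0) at_top"

end

theory Submission
  imports Defs "HOL-Complex_Analysis.Great_Picard"
begin

text \<open>
  By invariance, \<open>f a \<mapsto> f (z + a)\<close> and \<open>g a \<mapsto> g (z + a)\<close> (where \<open>g\<close> is the canonical dual of \<open>f\<close>) extend
  to operators bounded uniformly in \<open>z\<close>. Hence \<open>x \<mapsto> \<langle>u, f x\<rangle>\<close> is uniformly continuous and square integrable,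
  so \<open>f x\<close> tends weakly to \<open>0\<close> at infinity; for compact \<open>T\<close> this makes the Berezin transform vanish.

  Conversely, if the Berezin transform of \<open>T\<close> vanishes at infinity, every weak limit of translates of \<open>T\<close>
  along a sequence going to infinity has Berezin transform \<open>0\<close>, so it is \<open>0\<close> by injectivity.
  Hence the kernel \<open>\<langle>T (g x), f y\<rangle>\<close> tends to \<open>0\<close> as \<open>x\<close> goes to infinity, uniformly for \<open>dist x y \<le> R\<close>.
  Localization lets the Schur test discard the part of the kernel with \<open>dist x y > R\<close>, the decay lets it discard
  the part with \<open>x\<close> outside a large ball, and the remaining part is compactly supported.
\<close>

section \<open>Complex inner product spaces\<close>

text \<open>The hypothesis concerns only the mixed kernel \<open><g x, f y>\<close>, so translations
  need not be unitary, and \<open>g\<close> and \<open>f\<close> get different ones,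
  \<open>V z\<close> and \<open>W z\<close>. Unitarity is replaced by a bound \<open>C\<close>
  independent of \<open>z\<close>. The translate of \<open>T\<close> is the form sending
  \<open>(v, w)\<close> to \<open><T (V z v), W z w>\<close>.

  The Berezin transform sees the kernel on the diagonal, while compactness needs decay in a band
  around it. Injectivity bridges the gap but gives no quantitative bound for a single operator;
  hence the passage to a limit operator. Uniformity over the band comes from the relative position
  \<open>- x + y\<close>, which stays in a compact ball.

  The weight \<open>p\<close> may vary wildly over a distance \<open>R\<close>, so it is used for
  the far part; the near part is tested with weight one, all balls of radius \<open>R\<close> having
  the same finite measure. The compactly supported part is never treated as an operator: it is
  bounded by an integral of the modulus of \<open><v, f x>\<close> over a ball, which is continuous
  along weakly convergent bounded sequences.\<close>

text \<open>Conjugate symmetry carries the axiom for the first argument over to the second.\<close>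

lemma cinner_add_right: "cinner x (y + z) = cinner x y + cinner x (z :: 'h::complex_inner)"
  by (metis cinner_add_left cinner_commute complex_cnj_add)

lemma cinner_scaleC_right: "cinner x (c *\<^sub>C y) = cnj c * cinner x (y :: 'h::complex_inner)"
  by (metis cinner_commute cinner_scaleC_left complex_cnj_mult)

lemma cinner_scaleR_left: "cinner (r *\<^sub>R x) y = r *\<^sub>R cinner x (y :: 'h::complex_inner)"
  by (simp add: scaleR_scaleC cinner_scaleC_left scaleR_conv_of_real)

lemma cinner_scaleR_right: "cinner x (r *\<^sub>R y) = r *\<^sub>R cinner x (y :: 'h::complex_inner)"
  by (simp add: scaleR_scaleC cinner_scaleC_right scaleR_conv_of_real)

lemma cinner_self: "cinner x x = complex_of_real ((norm (x :: 'h::complex_inner))\<^sup>2)"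
proof -
  have "Im (cinner x x) = 0"
    using cinner_commute[of x x] by (simp add: complex_eq_iff)
  then show ?thesis
    using cinner_ge_zero[of x] by (simp add: norm_eq_sqrt_cinner complex_eq_iff)
qed

lemma norm_scaleC: "norm (c *\<^sub>C x) = cmod c * norm (x :: 'h::complex_inner)"
proof -
  have "complex_of_real ((norm (c *\<^sub>C x))\<^sup>2) = (c * cnj c) * cinner x x"
    unfolding cinner_self[symmetric] by (simp add: cinner_scaleC_left cinner_scaleC_right)
  also have "\<dots> = complex_of_real ((cmod c * norm x)\<^sup>2)"
    unfolding cinner_self complex_norm_square[symmetric] by (simp add: power_mult_distrib)
  finally have "complex_of_real ((norm (c *\<^sub>C x))\<^sup>2) = complex_of_real ((cmod c * norm x)\<^sup>2)" .
  then show ?thesis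
    by (metis of_real_eq_iff norm_ge_zero mult_nonneg_nonneg power2_eq_iff_nonneg)
qed

lemma cinner_bound: "cmod (cinner x y) \<le> norm x * norm (y :: 'h::complex_inner)"
proof (cases "y = 0")
  case True
  then show ?thesis using cinner_scaleR_right[of x 0 y] by simp
next
  case False
  define c where "c = cinner x y"
  define N where "N = (norm y)\<^sup>2"
  \<comment> \<open>\<open>z\<close> is \<open>N\<close> times the component of \<open>x\<close>
    orthogonal to \<open>y\<close>; the factor \<open>N\<close> avoids a division.\<close>
  define z where "z = N *\<^sub>R x + (- c) *\<^sub>C y"
  have N: "N > 0" using False by (simp add: N_def)
  have "cinner z z = N * (N * cinner x x) - N * (c * cnj c)"
    using cinner_commute[of y x]
    by (simp add: z_def cinner_add_left cinner_add_right cinner_scaleR_left cinner_scaleR_right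
       cinner_scaleC_left cinner_scaleC_right scaleR_conv_of_real c_def[symmetric] cinner_self[of y]
       N_def[symmetric] algebra_simps)
  also have "\<dots> = complex_of_real (N * (N * (norm x)\<^sup>2 - (cmod c)\<^sup>2))"
    by (simp add: cinner_self complex_norm_square[symmetric] algebra_simps)
  finally have "Re (cinner z z) = N * (N * (norm x)\<^sup>2 - (cmod c)\<^sup>2)" by simp
  then have "0 \<le> N * (norm x)\<^sup>2 - (cmod c)\<^sup>2"
    using cinner_ge_zero[of z] N by (simp add: zero_le_mult_iff)
  then have "(cmod c)\<^sup>2 \<le> (norm x * norm y)\<^sup>2" by (simp add: N_def power_mult_distrib mult.commute)
  then show ?thesis unfolding c_def by (meson mult_nonneg_nonneg norm_ge_zero power2_le_imp_le)
qed

interpretation cinner: bounded_bilinear "cinner :: 'h::complex_inner \<Rightarrow> 'h \<Rightarrow> complex"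
  by unfold_locales
    (auto simp: cinner_add_left cinner_add_right cinner_scaleR_left cinner_scaleR_right
      intro!: exI[of _ 1] cinner_bound)

lemma bounded_bilinear_Re_cinner: "bounded_bilinear (\<lambda>v w. Re (cinner v (w :: 'h::complex_inner)))"
  by (intro bounded_bilinear.intro exI[of _ 1] allI)
    (use abs_Re_le_cmod cinner_bound order_trans in
      \<open>fastforce simp: cinner.add_left cinner.add_right cinner_scaleR_left cinner_scaleR_right\<close>)+

lemma cinner_ext:
  assumes "\<And>w. cinner u w = cinner v (w :: 'h::complex_inner)"
  shows "u = v"
proof -
  have "cinner (u - v) (u - v) = 0" by (simp add: cinner.diff_left assms)
  then show ?thesis by (simp add: cinner_self)
qed

lemma norm_attained:
  obtains w where "norm w \<le> 1" "cmod (cinner u w) = norm (u :: 'h::complex_inner)"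
proof (cases "u = 0")
  case True
  then show ?thesis using that[of 0] by (simp add: cinner.zero_right)
next
  case False
  have "cinner u ((1 / norm u) *\<^sub>R u) = complex_of_real (norm u)"
    using False by (simp add: cinner_scaleR_right cinner_self power2_eq_square scaleR_conv_of_real)
  with False show ?thesis using that[of "(1 / norm u) *\<^sub>R u"] by simp
qed

text \<open>The representing vector minimises \<open>q v v - 2 * \<phi> v\<close>; the parallelogram law makes
  minimising sequences Cauchy.\<close>

lemma symmetric_Lax_Milgram:
  fixes q :: "'a::{real_normed_vector, complete_space} \<Rightarrow> 'a \<Rightarrow> real"
  assumes q: "bounded_bilinear q" and sym: "\<And>v w. q v w = q w v"
    and "c > 0" and coercive: "\<And>v. c * (norm v)\<^sup>2 \<le> q v v"
    and \<phi>: "bounded_linear \<phi>"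
  obtains v where "\<And>w. q v w = \<phi> w"
proof -
  interpret q: bounded_bilinear q by (rule q)
  interpret \<phi>: bounded_linear \<phi> by (rule \<phi>)
  define J where "J v = q v v - 2 * \<phi> v" for v
  have "bdd_below (range J)"
  proof -
    obtain K where K: "\<And>v. norm (\<phi> v) \<le> norm v * K" using \<phi>.bounded by blast
    have "- (K\<^sup>2 / c) \<le> J v" for v
    proof -
      \<comment> \<open>Completing the square bounds the quadratic part minus the linear part from
        below.\<close>
      have "0 \<le> (c * norm v - K)\<^sup>2 / c" using \<open>c > 0\<close> by simp
      also have "\<dots> = c * (norm v)\<^sup>2 - 2 * (norm v * K) + K\<^sup>2 / c"
        using \<open>c > 0\<close> by (simp add: power2_eq_square field_simps)
      also have "\<dots> \<le> J v + K\<^sup>2 / c"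
        using K[of v] coercive[of v] by (auto simp: J_def)
      finally show ?thesis by simp
    qed
    then show ?thesis by (metis bdd_belowI rangeE)
  qed
  define m where "m = Inf (range J)"
  have m: "m \<le> J v" for v
    unfolding m_def using \<open>bdd_below (range J)\<close> by (simp add: cInf_lower)
  have "\<exists>v. J v < m + 1 / real (Suc n)" for n
    using cInf_lessD[of "range J" "m + 1 / real (Suc n)"] by (auto simp: m_def)
  then obtain V where V: "\<And>n. J (V n) < m + 1 / real (Suc n)" by metis
  have par: "q (v - w) (v - w) = 2 * J v + 2 * J w - 4 * J ((1/2) *\<^sub>R (v + w))" for v w
    by (simp add: J_def q.diff_left q.diff_right q.add_left q.add_right q.scaleR_left q.scaleR_right
        \<phi>.add \<phi>.scaleR sym[of w v] field_simps)
  have "Cauchy V"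
  proof (rule CauchyI)
    fix e :: real assume "e > 0"
    then obtain N where N: "1 / real (Suc N) < c * e\<^sup>2 / 4"
      using nat_approx_posE[of "c * e\<^sup>2 / 4"] \<open>c > 0\<close> by (metis divide_pos_pos mult_pos_pos zero_less_numeral zero_less_power)
    have "norm (V i - V j) < e" if "i \<ge> N" "j \<ge> N" for i j
    proof -
      have le: "1 / real (Suc k) \<le> 1 / real (Suc N)" if "k \<ge> N" for k
        using that by (simp add: frac_le)
      have "c * (norm (V i - V j))\<^sup>2 \<le> q (V i - V j) (V i - V j)" by (rule coercive)
      also have "\<dots> < 4 * (1 / real (Suc N))"
        using par[of "V i" "V j"] V[of i] V[of j] m[of "(1/2) *\<^sub>R (V i + V j)"] le[OF that(1)] le[OF that(2)]
        by linarith
      also have "\<dots> < c * e\<^sup>2" using N by simp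
      finally have "(norm (V i - V j))\<^sup>2 < e\<^sup>2" using \<open>c > 0\<close> by simp
      then show ?thesis using \<open>e > 0\<close> by (simp add: power_less_imp_less_base)
    qed
    then show "\<exists>M. \<forall>i\<ge>M. \<forall>j\<ge>M. norm (V i - V j) < e" by blast
  qed
  then obtain v where v: "V \<longlonglongrightarrow> v" using Cauchy_convergent convergentD by blast
  have "(\<lambda>n. J (V n)) \<longlonglongrightarrow> J v"
    unfolding J_def by (intro tendsto_intros q.tendsto \<phi>.tendsto v)
  moreover have "(\<lambda>n. m + 1 / real (Suc n)) \<longlonglongrightarrow> m + 0"
    by (intro tendsto_intros LIMSEQ_Suc[OF lim_1_over_n])
  ultimately have "J v \<le> m"
    using LIMSEQ_le[of "\<lambda>n. J (V n)" "J v" "\<lambda>n. m + 1 / real (Suc n)" m] V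
    by (metis add.right_neutral less_imp_le)
  have "q v w = \<phi> w" for w
  proof (rule ccontr)
    assume "q v w \<noteq> \<phi> w"
    define d where "d = q v w - \<phi> w"
    have "d \<noteq> 0" using \<open>q v w \<noteq> \<phi> w\<close> by (simp add: d_def)
    have *: "0 \<le> 2 * t * d + t\<^sup>2 * q w w" for t
    proof -
      have "J (v + t *\<^sub>R w) = J v + 2 * t * d + t\<^sup>2 * q w w"
        by (simp add: J_def d_def q.add_left q.add_right q.scaleR_left q.scaleR_right
            \<phi>.add \<phi>.scaleR sym[of w v] power2_eq_square algebra_simps)
      then show ?thesis using m[of "v + t *\<^sub>R w"] \<open>J v \<le> m\<close> by linarith
    qed
    \<comment> \<open>The variation is tested at \<open>t = - d / Q\<close>, the minimiser of
      \<open>2 * t * d + t\<^sup>2 * Q\<close>; the summand 1 keeps \<open>Q\<close> positive when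
      \<open>q w w = 0\<close>.\<close>
    define Q where "Q = 1 + \<bar>q w w\<bar>"
    have "Q > 0" by (simp add: Q_def add_pos_nonneg)
    have "0 \<le> 2 * (- d / Q) * d + (- d / Q)\<^sup>2 * q w w" by (rule *)
    also have "\<dots> \<le> 2 * (- d / Q) * d + (- d / Q)\<^sup>2 * Q"
      by (intro add_left_mono mult_left_mono) (auto simp: Q_def)
    also have "\<dots> = - (d\<^sup>2 / Q)"
      using \<open>Q > 0\<close> by (simp add: power2_eq_square)
    also have "\<dots> < 0" using \<open>d \<noteq> 0\<close> \<open>Q > 0\<close> by simp
    finally show False by simp
  qed
  then show ?thesis using that by blast
qed

text \<open>Riesz representation, taken from \<open>symmetric_Lax_Milgram\<close> for the real form
  \<open>Re (cinner v w)\<close>. It is the source of all operators constructed below: translations,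
  the frame operator, adjoints and weak limits. The bound is required on unit vectors only, which
  suits estimates that are not homogeneous.\<close>

lemma sesquilinear_operator:
  fixes B :: "'h::chilbert_space \<Rightarrow> 'h \<Rightarrow> complex"
  assumes add_left: "\<And>u v w. B (u + v) w = B u w + B v w"
    and scale_left: "\<And>c v w. B (c *\<^sub>C v) w = c * B v w"
    and add_right: "\<And>u v w. B u (v + w) = B u v + B u w"
    and scale_right: "\<And>c v w. B v (c *\<^sub>C w) = cnj c * B v w"
    and bound: "\<And>v w. norm v \<le> 1 \<Longrightarrow> norm w \<le> 1 \<Longrightarrow> cmod (B v w) \<le> K"
  obtains U where "U \<in> bounded_operators" "\<And>v w. cinner (U v) w = B v w"
    "\<And>v. norm (U v) \<le> K * norm v"
proof -
  have scaleR: "B (r *\<^sub>R v) w = r * B v w" "B v (r *\<^sub>R w) = r * B v w" for r v w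
    by (simp_all add: scaleR_scaleC scale_left scale_right)
  have bnd: "cmod (B v w) \<le> K * (norm v * norm w)" for v w
  proof (cases "v = 0 \<or> w = 0")
    case True
    then show ?thesis using scaleR(1)[of 0 v w] scaleR(2)[of v 0 w] by auto
  next
    case False
    have "cmod (B ((1 / norm v) *\<^sub>R v) ((1 / norm w) *\<^sub>R w)) \<le> K"
      using False by (intro bound) auto
    then show ?thesis using False by (simp add: scaleR norm_mult norm_divide field_simps)
  qed
  have "\<exists>u. \<forall>w. cinner u w = B v w" for v
  proof -
    have "bounded_linear (\<lambda>w. Re (B v w))"
    proof (intro bounded_linear_intro[where K = "K * norm v"])
      show "norm (Re (B v w)) \<le> norm w * (K * norm v)" for w
        using abs_Re_le_cmod[of "B v w"] bnd[of v w] by (simp add: mult_ac)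
    qed (simp_all add: add_right scaleR)
    moreover have "Re (cinner v w) = Re (cinner w v)" for v w :: 'h
      by (subst cinner_commute) simp
    ultimately obtain u where u: "\<And>w. Re (cinner u w) = Re (B v w)"
      using symmetric_Lax_Milgram[of "\<lambda>v w. Re (cinner v w)" 1 "\<lambda>w. Re (B v w)"] bounded_bilinear_Re_cinner
      by (auto simp: cinner_self)
    \<comment> \<open>Real parts agree for all vectors; testing \<open>\<i> *\<^sub>C w\<close> as
      well recovers the imaginary part.\<close>
    have "cinner u w = B v w" for w
      using u[of w] u[of "\<i> *\<^sub>C w"]
      by (simp add: cinner_scaleC_right scale_right complex_eq_iff)
    then show ?thesis by blast
  qed
  then obtain U where U: "\<And>v w. cinner (U v) w = B v w" by metis
  have bU: "norm (U v) \<le> K * norm v" for v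
  proof -
    obtain w where "norm w \<le> 1" and w: "cmod (cinner (U v) w) = norm (U v)"
      using norm_attained by blast
    have "0 \<le> K" using bound[of 0 0] scaleR(1)[of 0 0 0] by simp
    have "cmod (cinner (U v) w) \<le> K * (norm v * norm w)" by (simp add: U bnd)
    also have "\<dots> \<le> K * (norm v * 1)"
      using \<open>norm w \<le> 1\<close> \<open>0 \<le> K\<close> by (intro mult_left_mono) auto
    finally show ?thesis by (simp add: w)
  qed
  have scaleC: "U (c *\<^sub>C v) = c *\<^sub>C U v" for c v
    by (rule cinner_ext) (simp add: U scale_left cinner_scaleC_left)
  have "bounded_linear U"
  proof (rule bounded_linear_intro[where K = K])
    show "U (v + w) = U v + U w" for v w
      by (rule cinner_ext) (simp add: U add_left cinner_add_left)
    show "U (r *\<^sub>R v) = r *\<^sub>R U v" for r v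
      by (simp add: scaleR_scaleC scaleC)
  qed (use bU in \<open>simp add: mult.commute\<close>)
  then show ?thesis using that U bU scaleC by (auto simp: bounded_operators_def)
qed

section \<open>Integrals of products and measurability\<close>

lemma cmod_cinner_commute: "cmod (cinner x y) = cmod (cinner y (x :: 'h::complex_inner))"
  by (metis cinner_commute complex_mod_cnj)

text \<open>The inequality of arithmetic and geometric means takes the place of Cauchy-Schwarz. The
  resulting bound is not homogeneous, but on unit vectors it gives the Bessel constant
  itself.\<close>

lemma square_integrable_product:
  fixes a b :: "'x \<Rightarrow> complex"
  assumes [measurable]: "a \<in> borel_measurable M" "b \<in> borel_measurable M"
    and a: "(\<integral>\<^sup>+x. ennreal ((cmod (a x))\<^sup>2) \<partial>M) \<le> ennreal A" and "0 \<le> A"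
    and b: "(\<integral>\<^sup>+x. ennreal ((cmod (b x))\<^sup>2) \<partial>M) \<le> ennreal B" and "0 \<le> B"
  shows "integrable M (\<lambda>x. a x * b x)"
    and "cmod (\<integral>x. a x * b x \<partial>M) \<le> (A + B) / 2"
proof -
  have "(\<integral>\<^sup>+x. ennreal (cmod (a x * b x)) \<partial>M)
      \<le> (\<integral>\<^sup>+x. ennreal (1/2) * (ennreal ((cmod (a x))\<^sup>2) + ennreal ((cmod (b x))\<^sup>2)) \<partial>M)"
  proof (rule nn_integral_mono)
    fix x
    have "cmod (a x * b x) \<le> 1/2 * ((cmod (a x))\<^sup>2 + (cmod (b x))\<^sup>2)"
      using sum_squares_bound[of "cmod (a x)" "cmod (b x)"] by (simp add: norm_mult)
    then show "ennreal (cmod (a x * b x))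
        \<le> ennreal (1/2) * (ennreal ((cmod (a x))\<^sup>2) + ennreal ((cmod (b x))\<^sup>2))"
      by (metis ennreal_leI ennreal_mult' ennreal_plus half_gt_zero_iff less_imp_le zero_less_one zero_le_power2)
  qed
  also have "\<dots> = ennreal (1/2) * ((\<integral>\<^sup>+x. ennreal ((cmod (a x))\<^sup>2) \<partial>M)
      + (\<integral>\<^sup>+x. ennreal ((cmod (b x))\<^sup>2) \<partial>M))"
    by (subst nn_integral_cmult) (auto simp: nn_integral_add)
  also have "\<dots> \<le> ennreal (1/2) * (ennreal A + ennreal B)"
    by (intro mult_left_mono add_mono a b) auto
  also have "\<dots> = ennreal ((A + B) / 2)"
    using \<open>0 \<le> A\<close> \<open>0 \<le> B\<close>
    by (subst ennreal_plus[symmetric], simp, simp, subst ennreal_mult'[symmetric]) simp_all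
  finally have *: "(\<integral>\<^sup>+x. ennreal (cmod (a x * b x)) \<partial>M) \<le> ennreal ((A + B) / 2)" .
  show int: "integrable M (\<lambda>x. a x * b x)"
    by (rule integrableI_bounded) (use * in \<open>auto simp: less_top[symmetric] top_unique\<close>)
  have "ennreal (cmod (\<integral>x. a x * b x \<partial>M)) \<le> ennreal ((A + B) / 2)"
    using integral_norm_bound_ennreal[OF int] * by (rule order_trans)
  then show "cmod (\<integral>x. a x * b x \<partial>M) \<le> (A + B) / 2"
    using \<open>0 \<le> A\<close> \<open>0 \<le> B\<close> by (simp add: ennreal_le_iff)
qed

text \<open>No integrability is required because the Bochner integral of a non-integrable function
  is 0 by convention.\<close>

lemma norm_integral_le_nn_integral:
  fixes h :: "'x \<Rightarrow> 'b::{banach, second_countable_topology}"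
  shows "ennreal (norm (\<integral>x. h x \<partial>M)) \<le> (\<integral>\<^sup>+x. ennreal (norm (h x)) \<partial>M)"
  by (cases "integrable M h") (auto simp: integral_norm_bound_ennreal not_integrable_integral_eq)

lemma borel_measurable_continuous_on_UNIV:
  assumes "sets M = sets borel" "continuous_on UNIV h"
  shows "h \<in> borel_measurable M"
  using assms borel_measurable_continuous_onI[of h] measurable_cong_sets[OF assms(1) refl] by blast

section \<open>Left Haar measures\<close>

lemma haar_measure_D:
  fixes \<mu> :: "'g::{topological_group_add, t2_space} measure"
  assumes "left_haar_measure \<mu>"
  shows sets_haar_measure: "sets \<mu> = sets borel" and space_haar_measure: "space \<mu> = UNIV"
  using assms sets_eq_imp_space_eq[of \<mu> borel] by (auto simp: left_haar_measure_def)

lemma measurable_translation: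
  fixes \<mu> :: "'g::{topological_group_add, t2_space} measure"
  assumes "left_haar_measure \<mu>"
  shows "(+) z \<in> measurable \<mu> \<mu>"
proof -
  have "(+) z \<in> measurable borel borel"
    by (intro borel_measurable_continuous_onI continuous_intros)
  then show ?thesis using measurable_cong_sets[OF sets_haar_measure sets_haar_measure, OF assms assms] by blast
qed

lemma distr_translation:
  fixes \<mu> :: "'g::{topological_group_add, t2_space} measure"
  assumes "left_haar_measure \<mu>"
  shows "distr \<mu> \<mu> ((+) z) = \<mu>"
proof (rule measure_eqI)
  fix A assume "A \<in> sets (distr \<mu> \<mu> ((+) z))"
  then have A: "A \<in> sets \<mu>" by simp
  have "(+) z -` A = (+) (- z) ` A"
    by (force simp: image_iff add.assoc[symmetric])
  then have "emeasure (distr \<mu> \<mu> ((+) z)) A = emeasure \<mu> ((+) (- z) ` A)"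
    using A by (simp add: emeasure_distr measurable_translation[OF assms] space_haar_measure[OF assms])
  also have "\<dots> = emeasure \<mu> A"
    using assms A unfolding left_haar_measure_def by blast
  finally show "emeasure (distr \<mu> \<mu> ((+) z)) A = emeasure \<mu> A" .
qed simp

lemma nn_integral_translation:
  fixes \<mu> :: "'g::{topological_group_add, t2_space} measure"
  assumes "left_haar_measure \<mu>" "h \<in> borel_measurable \<mu>"
  shows "(\<integral>\<^sup>+x. h (z + x) \<partial>\<mu>) = (\<integral>\<^sup>+x. h x \<partial>\<mu>)"
  using nn_integral_distr[OF measurable_translation[OF assms(1)], of h z] assms
  by (simp add: distr_translation)

lemma integral_translation:
  fixes \<mu> :: "'g::{topological_group_add, t2_space} measure"
    and h :: "'g \<Rightarrow> 'b::{banach, second_countable_topology}"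
  assumes "left_haar_measure \<mu>" "h \<in> borel_measurable \<mu>"
  shows "(\<integral>x. h (z + x) \<partial>\<mu>) = (\<integral>x. h x \<partial>\<mu>)"
  using integral_distr[OF measurable_translation[OF assms(1)], of h z] assms
  by (simp add: distr_translation)

lemma emeasure_cball_translation:
  fixes \<mu> :: "'g::{topological_group_add, metric_space} measure"
  assumes "left_haar_measure \<mu>" "left_invariant_metric TYPE('g)"
  shows "emeasure \<mu> (cball x r) = emeasure \<mu> (cball 0 r)"
proof -
  have "(+) x ` cball 0 r = cball x r"
  proof safe
    fix y assume "y \<in> cball x r"
    moreover have "dist 0 (- x + y) = dist (x + 0) (x + (- x + y))"
      using assms(2) unfolding left_invariant_metric_def by metis
    moreover have "x + (- x + y) = y" by (simp add: add.assoc[symmetric])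
    ultimately have "- x + y \<in> cball 0 r" by simp
    then show "y \<in> (+) x ` cball 0 r"
      by (intro image_eqI[of _ _ "- x + y"]) (auto simp: add.assoc[symmetric])
  next
    fix y :: 'g assume "y \<in> cball 0 r"
    moreover have "dist 0 y = dist (x + 0) (x + y)"
      using assms(2) unfolding left_invariant_metric_def by metis
    ultimately show "x + y \<in> cball x r" by simp
  qed
  moreover have "cball (0::'g) r \<in> sets borel" by simp
  ultimately show ?thesis using assms(1) unfolding left_haar_measure_def by metis
qed

section \<open>Dual frames\<close>

text \<open>A frame and its dual reduced to data symmetric in \<open>f\<close> and \<open>g\<close>:
  common constants \<open>A\<close> and \<open>C\<close>, Bessel bounds, and the reproducing formula
  in weak form. The symmetry lets each result about \<open>g\<close> be reused for
  \<open>f\<close>.\<close>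

locale dual_frames =
  fixes \<mu> :: "'g::{topological_group_add, metric_space, second_countable_topology} measure"
    and f g :: "'g \<Rightarrow> 'h::{chilbert_space, second_countable_topology}"
    and A C :: real
  assumes haar: "left_haar_measure \<mu>"
    and left_invariant: "left_invariant_metric TYPE('g)"
    and proper: "proper_metric TYPE('g)"
    and continuous_f: "continuous_on UNIV f" and continuous_g: "continuous_on UNIV g"
    and norm_f: "norm (f x) \<le> A" and norm_g: "norm (g x) \<le> A"
    and bessel_f: "(\<integral>\<^sup>+x. ennreal ((cmod (cinner v (f x)))\<^sup>2) \<partial>\<mu>) \<le> ennreal (C * (norm v)\<^sup>2)"
    and bessel_g: "(\<integral>\<^sup>+x. ennreal ((cmod (cinner v (g x)))\<^sup>2) \<partial>\<mu>) \<le> ennreal (C * (norm v)\<^sup>2)"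
    and C_pos: "C > 0"
    and reproducing: "cinner v w = (\<integral>x. cinner v (f x) * cinner (g x) w \<partial>\<mu>)"
    and invariant: "cinner (g x) (f y) = cinner (g (z + x)) (f (z + y))"
begin

lemma measurable_frame[measurable]:
  "(\<lambda>x. cinner v (f x)) \<in> borel_measurable \<mu>" "(\<lambda>x. cinner v (g x)) \<in> borel_measurable \<mu>"
  "(\<lambda>x. cinner (f x) v) \<in> borel_measurable \<mu>" "(\<lambda>x. cinner (g x) v) \<in> borel_measurable \<mu>"
  by (intro borel_measurable_continuous_on_UNIV[OF sets_haar_measure[OF haar]]
      cinner.continuous_on continuous_on_const continuous_f continuous_g)+

text \<open>Conjugation turns the reproducing formula and the invariance into the same statements
  with \<open>f\<close> and \<open>g\<close> exchanged.\<close>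

lemma swapped: "dual_frames \<mu> g f A C"
proof
  show "cinner v w = (\<integral>x. cinner v (g x) * cinner (f x) w \<partial>\<mu>)" for v w
  proof -
    have "cinner v w = cnj (\<integral>x. cinner w (f x) * cinner (g x) v \<partial>\<mu>)"
      by (metis cinner_commute reproducing)
    also have "\<dots> = (\<integral>x. cnj (cinner w (f x) * cinner (g x) v) \<partial>\<mu>)"
      by (rule Bochner_Integration.integral_cnj[symmetric])
    also have "\<dots> = (\<integral>x. cinner v (g x) * cinner (f x) w \<partial>\<mu>)"
      by (intro Bochner_Integration.integral_cong refl)
        (subst cinner_commute[of v], subst cinner_commute[of _ w], simp)
    finally show ?thesis .
  qed
  show "cinner (f x) (g y) = cinner (f (z + x)) (g (z + y))" for x y z
    by (subst (1 2) cinner_commute) (simp add: invariant[of y x z])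
qed (fact haar left_invariant proper continuous_f continuous_g norm_f norm_g bessel_f bessel_g C_pos)+

text \<open>\<open>V v\<close> is the weak integral of \<open><v, f x> g (z + x)\<close>. For
  \<open>v = g a\<close>, \<open>invariant\<close> rewrites the coefficient as
  \<open><g (z + a), f (z + x)>\<close>; shifting the variable then leaves the reproducing formula
  for \<open>g (z + a)\<close>. The bound does not depend on \<open>z\<close> because the translated
  family has the same Bessel constant.\<close>

lemma translation_operator:
  obtains V where "V \<in> bounded_operators" "\<And>v. norm (V v) \<le> C * norm v"
    "\<And>a. V (g a) = g (z + a)"
proof -
  have meas: "(\<lambda>x. cinner (g (z + x)) w) \<in> borel_measurable \<mu>" for w
    by (intro measurable_compose[OF measurable_translation[OF haar] measurable_frame(4)])
  have bound: "(\<integral>\<^sup>+x. ennreal ((cmod (cinner (g (z + x)) w))\<^sup>2) \<partial>\<mu>) \<le> ennreal (C * (norm w)\<^sup>2)" for w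
    by (subst nn_integral_translation[OF haar, of "\<lambda>x. ennreal ((cmod (cinner (g x) w))\<^sup>2)"])
      (use bessel_g[of w] in \<open>auto simp: cmod_cinner_commute[of _ w]\<close>)
  have int: "integrable \<mu> (\<lambda>x. cinner v (f x) * cinner (g (z + x)) w)" for v w
    using bessel_f[of v] bound[of w] C_pos
    by (intro square_integrable_product(1)[where A = "C * (norm v)\<^sup>2" and B = "C * (norm w)\<^sup>2"] meas) auto
  define B where "B v w = (\<integral>x. cinner v (f x) * cinner (g (z + x)) w \<partial>\<mu>)" for v w
  obtain V where V: "V \<in> bounded_operators" "\<And>v w. cinner (V v) w = B v w"
    "\<And>v. norm (V v) \<le> C * norm v"
  proof (rule sesquilinear_operator[of B C])
    show "B (u + v) w = B u w + B v w" for u v w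
      by (simp add: B_def cinner_add_left distrib_right int Bochner_Integration.integral_add)
    show "B u (v + w) = B u v + B u w" for u v w
      by (simp add: B_def cinner_add_right distrib_left int Bochner_Integration.integral_add)
    show "B (c *\<^sub>C v) w = c * B v w" for c v w
      by (simp add: B_def cinner_scaleC_left mult.assoc)
    show "B v (c *\<^sub>C w) = cnj c * B v w" for c v w
      by (simp add: B_def cinner_scaleC_right mult.left_commute)
    show "cmod (B v w) \<le> C" if "norm v \<le> 1" "norm w \<le> 1" for v w
    proof -
      have "cmod (B v w) \<le> (C * (norm v)\<^sup>2 + C * (norm w)\<^sup>2) / 2"
        unfolding B_def using bessel_f[of v] bound[of w] C_pos
        by (intro square_integrable_product(2) meas) auto
      also have "\<dots> \<le> (C * 1 + C * 1) / 2"
        using that C_pos by (intro divide_right_mono add_mono mult_left_mono power_le_one) auto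
      finally show ?thesis by simp
    qed
  qed (rule that)
  have "V (g a) = g (z + a)" for a
  proof (rule cinner_ext)
    fix w
    have "cinner (V (g a)) w = (\<integral>x. cinner (g (z + a)) (f (z + x)) * cinner (g (z + x)) w \<partial>\<mu>)"
      unfolding V(2) B_def using invariant[of a _ z] by simp
    also have "\<dots> = (\<integral>x. cinner (g (z + a)) (f x) * cinner (g x) w \<partial>\<mu>)"
      by (intro integral_translation[OF haar, of "\<lambda>x. cinner (g (z + a)) (f x) * cinner (g x) w"]) simp
    also have "\<dots> = cinner (g (z + a)) w" by (rule reproducing[symmetric])
    finally show "cinner (V (g a)) w = cinner (g (z + a)) w" .
  qed
  with V show ?thesis using that by blast
qed

end

text \<open>The frame operator \<open>S\<close> is represented by the form \<open>q\<close>; the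
  lower frame bound makes \<open>q\<close> coercive and hence \<open>S\<close> invertible. The
  inverse \<open>R\<close> is bounded and self-adjoint, so the Bessel bound and the reproducing
  formula for the dual follow from those of \<open>f\<close> by moving \<open>R\<close> to the other
  argument.\<close>

lemma continuous_frame_dual_frames:
  fixes \<mu> :: "'g::{topological_group_add, metric_space, second_countable_topology} measure"
    and f :: "'g \<Rightarrow> 'h::{chilbert_space, second_countable_topology}"
  assumes haar: "left_haar_measure \<mu>" and "left_invariant_metric TYPE('g)" "proper_metric TYPE('g)"
    and frame: "continuous_frame \<mu> f"
    and inv: "\<And>x y z. cinner (canonical_dual \<mu> f x) (f y) =
           cinner (canonical_dual \<mu> f (z + x)) (f (z + y))"
  obtains A C where "dual_frames \<mu> f (canonical_dual \<mu> f) A C"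
proof -
  have cont: "continuous_on UNIV f" and "bounded (range f)"
    using frame by (auto simp: continuous_frame_def)
  then obtain A where A: "\<And>x. norm (f x) \<le> A" by (auto simp: bounded_iff)
  obtain c C where "c > 0" "C > 0"
    and lower: "\<And>v. ennreal (c * (norm v)\<^sup>2) \<le> (\<integral>\<^sup>+x. ennreal ((cmod (cinner v (f x)))\<^sup>2) \<partial>\<mu>)"
    and upper: "\<And>v. (\<integral>\<^sup>+x. ennreal ((cmod (cinner v (f x)))\<^sup>2) \<partial>\<mu>) \<le> ennreal (C * (norm v)\<^sup>2)"
    using frame unfolding continuous_frame_def by metis
  have meas[measurable]: "(\<lambda>x. cinner v (f x)) \<in> borel_measurable \<mu>"
    "(\<lambda>x. cinner (f x) v) \<in> borel_measurable \<mu>" for v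
    by (intro borel_measurable_continuous_on_UNIV[OF sets_haar_measure[OF haar]]
        cinner.continuous_on continuous_on_const cont)+
  have upper': "(\<integral>\<^sup>+x. ennreal ((cmod (cinner (f x) v))\<^sup>2) \<partial>\<mu>) \<le> ennreal (C * (norm v)\<^sup>2)" for v
    using upper[of v] by (simp add: cmod_cinner_commute[of v])
  define q where "q v w = (\<integral>x. cinner v (f x) * cinner (f x) w \<partial>\<mu>)" for v w
  have int: "integrable \<mu> (\<lambda>x. cinner v (f x) * cinner (f x) w)" for v w
    using upper[of v] upper'[of w] \<open>C > 0\<close>
    by (intro square_integrable_product(1)[where A = "C * (norm v)\<^sup>2" and B = "C * (norm w)\<^sup>2"]) auto
  obtain S where S: "S \<in> bounded_operators" "\<And>v w. cinner (S v) w = q v w"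
    "\<And>v. norm (S v) \<le> C * norm v"
  proof (rule sesquilinear_operator[of q C])
    show "q (u + v) w = q u w + q v w" for u v w
      by (simp add: q_def cinner_add_left distrib_right int Bochner_Integration.integral_add)
    show "q u (v + w) = q u v + q u w" for u v w
      by (simp add: q_def cinner_add_right distrib_left int Bochner_Integration.integral_add)
    show "q (c *\<^sub>C v) w = c * q v w" for c v w
      by (simp add: q_def cinner_scaleC_left mult.assoc)
    show "q v (c *\<^sub>C w) = cnj c * q v w" for c v w
      by (simp add: q_def cinner_scaleC_right mult.left_commute)
    show "cmod (q v w) \<le> C" if "norm v \<le> 1" "norm w \<le> 1" for v w
    proof -
      have "cmod (q v w) \<le> (C * (norm v)\<^sup>2 + C * (norm w)\<^sup>2) / 2"
        unfolding q_def using upper[of v] upper'[of w] \<open>C > 0\<close>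
        by (intro square_integrable_product(2)) auto
      also have "\<dots> \<le> (C * 1 + C * 1) / 2"
        using that \<open>C > 0\<close> by (intro divide_right_mono add_mono mult_left_mono power_le_one) auto
      finally show ?thesis by simp
    qed
  qed (rule that)
  \<comment> \<open>The definite description is meaningful: \<open>S v\<close> is a representing
    vector, and \<open>cinner_ext\<close> makes it unique.\<close>
  have "frame_operator \<mu> f v = S v" for v
    unfolding frame_operator_def q_def[symmetric]
    by (rule the_equality) (auto simp: S(2) intro: cinner_ext)
  then have frame_op: "frame_operator \<mu> f = S" by blast
  have q_commute: "q v w = cnj (q w v)" for v w
    unfolding q_def Bochner_Integration.integral_cnj[symmetric]
    by (intro Bochner_Integration.integral_cong refl)
      (subst cinner_commute[of v], subst cinner_commute[of _ w], simp)
  have coercive: "c * (norm v)\<^sup>2 \<le> Re (q v v)" for v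
  proof -
    have eq: "cinner v (f x) * cinner (f x) v = complex_of_real ((cmod (cinner v (f x)))\<^sup>2)" for x
      by (subst cinner_commute[of "f x" v]) (rule complex_norm_square[symmetric])
    have "integrable \<mu> (\<lambda>x. Re (cinner v (f x) * cinner (f x) v))"
      using int by (rule integrable_Re)
    then have "integrable \<mu> (\<lambda>x. (cmod (cinner v (f x)))\<^sup>2)" unfolding eq Re_complex_of_real .
    then have "(\<integral>\<^sup>+x. ennreal ((cmod (cinner v (f x)))\<^sup>2) \<partial>\<mu>) = ennreal (\<integral>x. (cmod (cinner v (f x)))\<^sup>2 \<partial>\<mu>)"
      by (intro nn_integral_eq_integral) simp_all
    moreover have "q v v = complex_of_real (\<integral>x. (cmod (cinner v (f x)))\<^sup>2 \<partial>\<mu>)"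
      unfolding q_def eq by (rule integral_complex_of_real)
    ultimately show ?thesis using lower[of v] by (simp add: ennreal_le_iff)
  qed
  have lS: "bounded_linear S" "\<And>c v. S (c *\<^sub>C v) = c *\<^sub>C S v" using S(1) by (auto simp: bounded_operators_def)
  have expand: "c * norm v \<le> norm (S v)" for v
  proof -
    have "c * (norm v)\<^sup>2 \<le> Re (cinner (S v) v)" using coercive by (simp add: S(2))
    also have "\<dots> \<le> norm (S v) * norm v" using complex_Re_le_cmod[of "cinner (S v) v"] cinner_bound[of "S v" v] by linarith
    finally show ?thesis
      by (cases "v = 0") (simp_all add: power2_eq_square flip: mult.assoc)
  qed
  have "inj S"
  proof (rule injI)
    fix u v assume "S u = S v"
    then have "S (u - v) = 0" using bounded_linear.linear[OF lS(1)] by (simp add: linear_diff)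
    then show "u = v" using expand[of "u - v"] \<open>c > 0\<close> by (simp add: mult_le_0_iff)
  qed
  have "surj S"
    unfolding surj_def
  proof
    fix u :: 'h
    \<comment> \<open>Surjectivity is the solvability of \<open>q v w = cinner u w\<close>, obtained
      first for real parts.\<close>
    have "bounded_bilinear (\<lambda>v w. Re (q v w))"
      using bounded_bilinear.comp1[OF bounded_bilinear_Re_cinner lS(1)] by (simp add: S(2))
    moreover have "Re (q v w) = Re (q w v)" for v w by (subst q_commute) simp
    moreover have "bounded_linear (\<lambda>w. Re (cinner u w))"
      by (rule bounded_bilinear.bounded_linear_right[OF bounded_bilinear_Re_cinner])
    ultimately obtain v where v: "\<And>w. Re (q v w) = Re (cinner u w)"
      using symmetric_Lax_Milgram[of "\<lambda>v w. Re (q v w)" c "\<lambda>w. Re (cinner u w)"]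
        \<open>c > 0\<close> coercive by blast
    have "S v = u"
    proof (rule cinner_ext)
      fix w
      show "cinner (S v) w = cinner u w"
        using v[of w] v[of "\<i> *\<^sub>C w"]
        by (simp add: S(2)[symmetric] cinner_scaleC_right complex_eq_iff)
    qed
    then show "\<exists>v. u = S v" by blast
  qed
  define R where "R = inv S"
  have SR: "S (R v) = v" and RS: "R (S v) = v" for v
    using \<open>inj S\<close> \<open>surj S\<close> by (auto simp: R_def surj_f_inv_f)
  have g: "canonical_dual \<mu> f x = R (f x)" for x
    by (simp add: canonical_dual_def frame_op R_def)
  have norm_R: "norm (R v) \<le> (1 / c) * norm v" for v
    using expand[of "R v"] \<open>c > 0\<close> by (simp add: SR pos_le_divide_eq mult.commute)
  have "bounded_linear R"
  proof (rule bounded_linear_intro[where K = "1 / c"])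
    show "R (v + w) = R v + R w" for v w
      using RS[of "R v + R w"] by (simp add: linear_add[OF bounded_linear.linear[OF lS(1)]] SR)
    show "R (r *\<^sub>R v) = r *\<^sub>R R v" for r v
      using RS[of "r *\<^sub>R R v"] by (simp add: linear_scale[OF bounded_linear.linear[OF lS(1)]] SR)
  qed (use norm_R in \<open>simp add: mult.commute\<close>)
  have self_adjoint: "cinner (R v) w = cinner v (R w)" for v w
  proof -
    have "cinner (R v) w = cinner (R v) (S (R w))" by (simp add: SR)
    also have "\<dots> = cnj (q (R w) (R v))" by (subst cinner_commute) (simp add: S(2))
    also have "\<dots> = cinner (S (R v)) (R w)" by (simp add: S(2) flip: q_commute)
    finally show ?thesis by (simp add: SR)
  qed
  have normR2: "(norm (R v))\<^sup>2 \<le> (norm v)\<^sup>2 / c\<^sup>2" for v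
    using power_mono[OF norm_R[of v], of 2] by (simp add: power_mult_distrib power_divide)
  \<comment> \<open>The passage to \<open>R v\<close> costs the factor \<open>1 / c\<^sup>2\<close>;
    the maximum serves \<open>f\<close> and its dual at once.\<close>
  define C' where "C' = max C (C / c\<^sup>2)"
  have "dual_frames \<mu> f (canonical_dual \<mu> f) (max A (A / c)) C'"
  proof
    show "continuous_on UNIV (canonical_dual \<mu> f)"
      unfolding g by (intro bounded_linear.continuous_on[OF \<open>bounded_linear R\<close>] cont)
    show "norm (f x) \<le> max A (A / c)" for x using A[of x] by simp
    show "norm (canonical_dual \<mu> f x) \<le> max A (A / c)" for x
    proof -
      have "norm (R (f x)) \<le> (1 / c) * A"
        using norm_R[of "f x"] A[of x] \<open>c > 0\<close> by (meson divide_pos_pos less_imp_le mult_left_mono order_trans zero_less_one)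
      then show ?thesis by (simp add: g)
    qed
    show "(\<integral>\<^sup>+x. ennreal ((cmod (cinner v (f x)))\<^sup>2) \<partial>\<mu>) \<le> ennreal (C' * (norm v)\<^sup>2)" for v
      by (rule order_trans[OF upper], intro ennreal_leI mult_right_mono) (simp_all add: C'_def)
    show "(\<integral>\<^sup>+x. ennreal ((cmod (cinner v (canonical_dual \<mu> f x)))\<^sup>2) \<partial>\<mu>) \<le> ennreal (C' * (norm v)\<^sup>2)" for v
    proof -
      have "(\<integral>\<^sup>+x. ennreal ((cmod (cinner v (canonical_dual \<mu> f x)))\<^sup>2) \<partial>\<mu>)
          = (\<integral>\<^sup>+x. ennreal ((cmod (cinner (R v) (f x)))\<^sup>2) \<partial>\<mu>)"
        by (simp add: g self_adjoint)
      also have "\<dots> \<le> ennreal (C * (norm (R v))\<^sup>2)" by (rule upper)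
      also have "\<dots> \<le> ennreal (C * ((norm v)\<^sup>2 / c\<^sup>2))"
        using \<open>C > 0\<close> by (intro ennreal_leI mult_left_mono normR2) auto
      also have "\<dots> = ennreal ((C / c\<^sup>2) * (norm v)\<^sup>2)" by (simp add: field_simps)
      also have "\<dots> \<le> ennreal (C' * (norm v)\<^sup>2)"
        by (intro ennreal_leI mult_right_mono) (simp_all add: C'_def)
      finally show ?thesis .
    qed
    show "C' > 0" using \<open>C > 0\<close> by (simp add: C'_def)
    show "cinner v w = (\<integral>x. cinner v (f x) * cinner (canonical_dual \<mu> f x) w \<partial>\<mu>)" for v w
    proof -
      have "cinner v w = q v (R w)" by (simp add: S(2)[symmetric] self_adjoint[symmetric] RS)
      then show ?thesis by (simp add: q_def g self_adjoint)
    qed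
  qed (fact assms cont)+
  then show ?thesis using that by blast
qed

section \<open>Convergent subsequences\<close>

text \<open>The pointwise half of Arzela-Ascoli: a diagonal sequence converges on a countable dense
  set, and equicontinuity makes it Cauchy at every point. Applied to pairings on a separable Hilbert
  space it does the work of weak sequential compactness.\<close>

lemma equicontinuous_convergent_subsequence:
  fixes F :: "nat \<Rightarrow> 'a::{metric_space, second_countable_topology} \<Rightarrow> complex"
  assumes bounded: "\<And>n x. norm (F n x) \<le> M x"
    and equicontinuous: "\<And>x e. e > 0 \<Longrightarrow> \<exists>d>0. \<forall>n y. dist x y < d \<longrightarrow> norm (F n x - F n y) < e"
  obtains k :: "nat \<Rightarrow> nat" where "strict_mono k" "\<And>x. convergent (\<lambda>n. F (k n) x)"
proof -
  obtain D :: "'a set" where "countable D" and dense: "\<And>X. open X \<Longrightarrow> X \<noteq> {} \<Longrightarrow> \<exists>d\<in>D. d \<in> X"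
    using countable_dense_setE by metis
  have M: "0 \<le> M x" for x using bounded[of 0 x] norm_ge_zero order_trans by blast
  \<comment> \<open>The diagonal argument wants one bound for all points, so values are rescaled;
    the summand 1 keeps the divisor nonzero.\<close>
  have *: "norm (F n x / of_real (1 + M x)) \<le> 1" for n x
    unfolding norm_divide norm_of_real using bounded[of n x] M[of x] by simp
  obtain k :: "nat \<Rightarrow> nat" where "strict_mono k"
    and k: "\<And>x. x \<in> D \<Longrightarrow> \<exists>l. (\<lambda>n. F (k n) x / of_real (1 + M x)) \<longlonglongrightarrow> l"
    using function_convergent_subsequence[OF \<open>countable D\<close>, of "\<lambda>n x. F n x / of_real (1 + M x)" 1] * by blast
  have conv: "convergent (\<lambda>n. F (k n) x)" if "x \<in> D" for x
  proof -
    obtain l where "(\<lambda>n. F (k n) x / of_real (1 + M x)) \<longlonglongrightarrow> l" using k \<open>x \<in> D\<close> by blast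
    then have "(\<lambda>n. (F (k n) x / of_real (1 + M x)) * of_real (1 + M x)) \<longlonglongrightarrow> l * of_real (1 + M x)"
      by (rule tendsto_mult_right)
    moreover have "of_real (1 + M x) \<noteq> (0::complex)" using M[of x] by (simp only: of_real_eq_0_iff)
    ultimately show ?thesis by (auto simp: convergent_def simp del: of_real_add)
  qed
  have "convergent (\<lambda>n. F (k n) x)" for x
  proof (rule Cauchy_convergent, rule CauchyI)
    fix e :: real assume "e > 0"
    then obtain d where "d > 0" and d: "\<And>n y. dist x y < d \<Longrightarrow> norm (F n x - F n y) < e / 3"
      using equicontinuous[of "e / 3" x] by auto
    obtain y where "y \<in> D" "y \<in> ball x d" using dense[of "ball x d"] \<open>d > 0\<close> by auto
    then obtain N where N: "\<And>i j. i \<ge> N \<Longrightarrow> j \<ge> N \<Longrightarrow> norm (F (k i) y - F (k j) y) < e / 3"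
      using convergent_Cauchy[OF conv] \<open>e > 0\<close> CauchyD[of "\<lambda>n. F (k n) y" "e / 3"] by auto
    have "norm (F (k i) x - F (k j) x) < e" if "i \<ge> N" "j \<ge> N" for i j
    proof -
      have "F (k i) x - F (k j) x = (F (k i) x - F (k i) y) + (F (k i) y - F (k j) y) - (F (k j) x - F (k j) y)"
        by simp
      also have "norm \<dots> \<le> norm (F (k i) x - F (k i) y) + norm (F (k i) y - F (k j) y) + norm (F (k j) x - F (k j) y)"
        by (meson add_mono_thms_linordered_semiring(3) norm_triangle_ineq norm_triangle_ineq4 order_trans)
      finally show ?thesis
        using d[of y "k i"] d[of y "k j"] N[OF that] \<open>y \<in> ball x d\<close> by simp
    qed
    then show "\<exists>N. \<forall>i\<ge>N. \<forall>j\<ge>N. norm (F (k i) x - F (k j) x) < e" by blast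
  qed
  with \<open>strict_mono k\<close> show ?thesis using that by blast
qed

text \<open>A sequence in the closure is shadowed by one in \<open>S\<close> at distance below
  \<open>1 / real (Suc n)\<close>, so both converge along the same subsequence.\<close>

lemma compact_closureI_sequence:
  fixes S :: "'a::metric_space set"
  assumes "\<And>s. (\<And>n::nat. s n \<in> S) \<Longrightarrow> \<exists>k l. strict_mono k \<and> (s \<circ> k) \<longlonglongrightarrow> l"
  shows "compact (closure S)"
  unfolding compact_eq_seq_compact_metric seq_compact_def
proof (intro allI impI)
  fix y :: "nat \<Rightarrow> 'a" assume y: "\<forall>n. y n \<in> closure S"
  have "\<exists>s\<in>S. dist s (y n) < 1 / real (Suc n)" for n
    using y by (simp add: closure_approachable)
  then obtain s where s: "\<And>n. s n \<in> S" "\<And>n. dist (s n) (y n) < 1 / real (Suc n)" by metis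
  obtain k l where "strict_mono k" and l: "(s \<circ> k) \<longlonglongrightarrow> l" using assms[of s] s(1) by blast
  have "(\<lambda>n. dist (s n) (y n)) \<longlonglongrightarrow> 0"
    by (rule real_tendsto_sandwich[OF _ _ tendsto_const LIMSEQ_Suc[OF lim_1_over_n]])
      (use s(2) in \<open>auto intro!: always_eventually less_imp_le\<close>)
  then have "(\<lambda>n. dist ((s \<circ> k) n) ((y \<circ> k) n)) \<longlonglongrightarrow> 0"
    using LIMSEQ_subseq_LIMSEQ[OF _ \<open>strict_mono k\<close>] by (auto simp: o_def)
  then have "(\<lambda>n. dist ((s \<circ> k) n) ((y \<circ> k) n) + dist ((s \<circ> k) n) l) \<longlonglongrightarrow> 0 + 0"
    using l by (intro tendsto_add) (simp_all only: tendsto_dist_iff[symmetric])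
  then have lim: "(\<lambda>n. dist ((s \<circ> k) n) ((y \<circ> k) n) + dist ((s \<circ> k) n) l) \<longlonglongrightarrow> 0" by simp
  have "(\<lambda>n. dist ((y \<circ> k) n) l) \<longlonglongrightarrow> 0"
    by (rule real_tendsto_sandwich[OF _ _ tendsto_const lim])
      (rule always_eventually, rule allI, rule zero_le_dist dist_triangle3)+
  then have "(y \<circ> k) \<longlonglongrightarrow> l" by (simp only: tendsto_dist_iff[symmetric])
  moreover have "l \<in> closure S"
    unfolding closure_sequential using l s(1) by (intro exI[of _ "s \<circ> k"]) simp
  ultimately show "\<exists>l\<in>closure S. \<exists>r. strict_mono r \<and> (y \<circ> r) \<longlonglongrightarrow> l"
    using \<open>strict_mono k\<close> by blast
qed

section \<open>Decay at infinity\<close>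

lemma bounded_operatorsD:
  assumes "T \<in> bounded_operators"
  shows "bounded_linear T" "T (c *\<^sub>C x) = c *\<^sub>C T x"
  using assms by (auto simp: bounded_operators_def)

text \<open>Unfolds the filter of the theorem; on a bounded group the filter is trivial and every
  limit along it holds.\<close>

lemma eventually_at_infinity_dist:
  "eventually P (filtercomap (\<lambda>x::'a::metric_space. dist x a) at_top) \<longleftrightarrow>
    (\<exists>\<rho>::real. \<forall>x. dist x a > \<rho> \<longrightarrow> P x)"
  by (auto simp: eventually_filtercomap_at_top_dense)

context dual_frames
begin

section \<open>Measures of balls and weak convergence of the frame vectors\<close>

lemma emeasure_cball_finite: "emeasure \<mu> (cball x r) < \<infinity>"
proof -
  have "compact (cball x r)" using proper by (simp add: proper_metric_def)
  then show ?thesis using haar by (simp add: left_haar_measure_def)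
qed

lemma sigma_finite_haar: "sigma_finite_measure \<mu>"
proof
  have "(\<Union>n. cball 0 (real n)) = (UNIV :: 'g set)"
    by (auto simp: real_arch_simple)
  then show "\<exists>A. countable A \<and> A \<subseteq> sets \<mu> \<and> \<Union>A = space \<mu> \<and> (\<forall>a\<in>A. emeasure \<mu> a \<noteq> \<infinity>)"
    using emeasure_cball_finite
    by (intro exI[of _ "range (\<lambda>n. cball 0 (real n))"])
      (auto simp: sets_haar_measure[OF haar] space_haar_measure[OF haar] less_top)
qed

text \<open>If one ball were null, all balls of that radius would be, and countably many of them,
  centred at a dense set, cover the group; but the Haar measure is nonzero.\<close>

lemma emeasure_cball_pos:
  assumes "r > 0"
  shows "emeasure \<mu> (cball 0 r) > 0"
proof (rule ccontr)
  assume "\<not> emeasure \<mu> (cball 0 r) > 0"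
  then have "cball x r \<in> null_sets \<mu>" for x
    by (simp add: null_sets_def sets_haar_measure[OF haar] emeasure_cball_translation[OF haar left_invariant, of x])
  moreover obtain D :: "'g set" where "countable D" and dense: "\<And>X. open X \<Longrightarrow> X \<noteq> {} \<Longrightarrow> \<exists>d\<in>D. d \<in> X"
    using countable_dense_setE by metis
  ultimately have "(\<Union>x\<in>D. cball x r) \<in> null_sets \<mu>" by (intro null_sets_UN') auto
  moreover have "(\<Union>x\<in>D. cball x r) = UNIV"
  proof -
    have "\<exists>x\<in>D. y \<in> cball x r" for y
    proof -
      obtain x where "x \<in> D" "x \<in> ball y r" using dense[of "ball y r"] \<open>r > 0\<close> by auto
      then show ?thesis by (auto simp: dist_commute intro!: bexI[of _ x])
    qed
    then show ?thesis by blast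
  qed
  ultimately show False using haar by (auto simp: left_haar_measure_def null_sets_def)
qed

text \<open>Continuity at 0 is transported to every point: \<open>g x - g y\<close> is the image of
  \<open>g 0 - g (- x + y)\<close> under the translation by \<open>x\<close>, whose norm is at most
  \<open>C\<close> for all \<open>x\<close>.\<close>

lemma uniformly_continuous_g:
  assumes "e > 0"
  obtains d where "d > 0" "\<And>x y. dist x y < d \<Longrightarrow> norm (g x - g y) < e"
proof -
  have "isCont g 0" using continuous_g by (simp add: continuous_on_eq_continuous_at)
  then obtain d where "d > 0" and d: "\<And>y. dist y 0 < d \<Longrightarrow> dist (g y) (g 0) < e / C"
    using C_pos \<open>e > 0\<close> unfolding continuous_at_eps_delta by (meson divide_pos_pos)
  have "norm (g x - g y) < e" if "dist x y < d" for x y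
  proof -
    obtain V where V: "V \<in> bounded_operators" "\<And>v. norm (V v) \<le> C * norm v" "\<And>a. V (g a) = g (x + a)"
      using translation_operator by blast
    have "dist 0 (- x + y) = dist (x + 0) (x + (- x + y))"
      using left_invariant unfolding left_invariant_metric_def by metis
    moreover have "x + (- x + y) = y" by (simp add: add.assoc[symmetric])
    ultimately have *: "dist (- x + y) 0 < d" "x + (- x + y) = y"
      using that by (simp_all add: dist_commute)
    have "g x - g y = V (g 0 - g (- x + y))"
      using * by (simp add: V(3) linear_diff[OF bounded_linear.linear[OF bounded_operatorsD(1)[OF V(1)]]])
    also have "norm \<dots> \<le> C * norm (g 0 - g (- x + y))" by (rule V(2))
    also have "\<dots> < C * (e / C)"
      using d[OF *(1)] C_pos by (intro mult_strict_left_mono) (auto simp: dist_norm norm_minus_commute)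
    finally show ?thesis using C_pos by simp
  qed
  with \<open>d > 0\<close> show ?thesis using that by blast
qed

text \<open>A uniformly continuous square integrable function vanishes at infinity, because all balls of
  a given radius have the same positive measure.\<close>

lemma g_weakly_null: "((\<lambda>x. cinner u (g x)) \<longlongrightarrow> 0) (filtercomap (\<lambda>x. dist x 0) at_top)"
proof (rule tendstoI)
  fix e :: real assume "e > 0"
  \<comment> \<open>This \<open>d\<close> keeps \<open>cmod (cinner u (g y))\<close> above
    \<open>e / 2\<close> on a ball of radius \<open>d / 2\<close> around any point where it is at
    least \<open>e\<close>; the summand 1 covers \<open>u = 0\<close>.\<close>
  obtain d where "d > 0" and d: "\<And>x y. dist x y < d \<Longrightarrow> norm (g x - g y) < (e / 2) / (norm u + 1)"
    using uniformly_continuous_g[of "(e / 2) / (norm u + 1)"] \<open>e > 0\<close>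
    by (auto simp: add_nonneg_pos)
  define m where "m = emeasure \<mu> (cball 0 (d / 2))"
  define h :: "'g \<Rightarrow> ennreal" where "h x = ennreal ((cmod (cinner u (g x)))\<^sup>2)" for x :: 'g
  have h[measurable]: "h \<in> borel_measurable \<mu>" unfolding h_def by measurable
  have [measurable]: "cball x r \<in> sets \<mu>" for x :: 'g and r by (simp add: sets_haar_measure[OF haar])
  have "(\<lambda>n. \<integral>\<^sup>+x. h x * indicator (- cball 0 (real n)) x \<partial>\<mu>) \<longlonglongrightarrow> (\<integral>\<^sup>+x. 0 \<partial>\<mu>)"
  proof (rule nn_integral_dominated_convergence[where w = h])
    show "AE x in \<mu>. (\<lambda>n. h x * indicator (- cball 0 (real n)) x) \<longlonglongrightarrow> 0"
    proof (rule AE_I2, rule tendsto_eventually)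
      fix x :: 'g
      obtain N where "dist 0 x \<le> real N" using real_arch_simple by blast
      then have "h x * indicator (- cball 0 (real n)) x = 0" if "n \<ge> N" for n
        using that by (simp add: indicator_def)
      then show "\<forall>\<^sub>F n in sequentially. h x * indicator (- cball 0 (real n)) x = 0"
        by (auto simp: eventually_sequentially)
    qed
    show "(\<integral>\<^sup>+x. h x \<partial>\<mu>) < \<infinity>"
      using bessel_g[of u] unfolding h_def by (rule order.strict_trans1) simp
    show "(\<lambda>x. h x * indicator (- cball 0 (real n)) x) \<in> borel_measurable \<mu>" for n
      by (intro borel_measurable_times_ennreal h borel_measurable_indicator) (simp add: sets_haar_measure[OF haar])
  qed (auto simp: indicator_def)
  moreover have "ennreal ((e / 2)\<^sup>2) * m > 0"
    using emeasure_cball_pos[of "d / 2"] \<open>d > 0\<close> \<open>e > 0\<close> by (simp add: m_def ennreal_zero_less_mult_iff)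
  ultimately have "\<forall>\<^sub>F n in sequentially.
      (\<integral>\<^sup>+x. h x * indicator (- cball 0 (real n)) x \<partial>\<mu>) < ennreal ((e / 2)\<^sup>2) * m"
    by (intro order_tendstoD(2)[where y = 0]) simp_all
  then obtain n where n: "(\<integral>\<^sup>+x. h x * indicator (- cball 0 (real n)) x \<partial>\<mu>) < ennreal ((e / 2)\<^sup>2) * m"
    by (auto simp: eventually_sequentially)
  \<comment> \<open>Beyond \<open>real n + d\<close> the ball of radius \<open>d / 2\<close> around
    \<open>x\<close> misses \<open>cball 0 (real n)\<close>, so a large value at \<open>x\<close>
    would contribute at least \<open>ennreal ((e / 2)\<^sup>2) * m\<close> to the tail
    integral.\<close>
  have "cmod (cinner u (g x)) < e" if "dist x 0 > real n + d" for x
  proof (rule ccontr)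
    assume "\<not> cmod (cinner u (g x)) < e"
    have ge: "e / 2 \<le> cmod (cinner u (g y))" if "y \<in> cball x (d / 2)" for y
    proof -
      have "cmod (cinner u (g x - g y)) \<le> norm u * norm (g x - g y)" by (rule cinner_bound)
      also have "\<dots> \<le> norm u * ((e / 2) / (norm u + 1))"
        using less_imp_le[OF d[of x y]] that \<open>d > 0\<close> by (intro mult_left_mono) auto
      also have "\<dots> = (e / 2) * (norm u / (norm u + 1))" by simp
      also have "\<dots> \<le> (e / 2) * 1"
        using \<open>e > 0\<close> by (intro mult_left_mono) (simp_all add: add_nonneg_pos)
      also have "\<dots> = e / 2" by simp
      finally have "cmod (cinner u (g x) - cinner u (g y)) \<le> e / 2" by (simp add: cinner.diff_right)
      then show ?thesis
        using \<open>\<not> cmod (cinner u (g x)) < e\<close> norm_triangle_ineq2[of "cinner u (g x)" "cinner u (g y)"] by linarith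
    qed
    have "ennreal ((e / 2)\<^sup>2) * m = (\<integral>\<^sup>+y. ennreal ((e / 2)\<^sup>2) * indicator (cball x (d / 2)) y \<partial>\<mu>)"
      by (subst nn_integral_cmult_indicator)
        (simp_all add: m_def emeasure_cball_translation[OF haar left_invariant, of x])
    also have "\<dots> \<le> (\<integral>\<^sup>+x. h x * indicator (- cball 0 (real n)) x \<partial>\<mu>)"
    proof (rule nn_integral_mono)
      fix y
      show "ennreal ((e / 2)\<^sup>2) * indicator (cball x (d / 2)) y \<le> h y * indicator (- cball 0 (real n)) y"
      proof (cases "y \<in> cball x (d / 2)")
        case True
        have "dist x 0 \<le> dist x y + dist 0 y" by (metis dist_commute dist_triangle)
        then have "y \<notin> cball 0 (real n)" using True \<open>d > 0\<close> \<open>dist x 0 > real n + d\<close> by simp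
        then show ?thesis using ge[OF True] True \<open>e > 0\<close>
          by (simp add: h_def ennreal_leI power_mono del: mem_cball)
      qed simp
    qed
    finally show False using n by simp
  qed
  then show "\<forall>\<^sub>F x in filtercomap (\<lambda>x. dist x 0) at_top. dist (cinner u (g x)) 0 < e"
    unfolding eventually_at_infinity_dist by auto
qed

lemma f_weakly_null: "((\<lambda>x. cinner u (f x)) \<longlongrightarrow> 0) (filtercomap (\<lambda>x. dist x 0) at_top)"
  by (rule dual_frames.g_weakly_null[OF swapped])

section \<open>Compactness forces the Berezin transform to vanish\<close>

lemma A_nonneg: "0 \<le> A"
  using norm_f[of 0] norm_ge_zero order_trans by blast

text \<open>Total boundedness replaces the vectors \<open>T (g x)\<close>, up to scaling and a small
  error, by finitely many \<open>u\<close>, and for these \<open>cinner u (f x)\<close> tends to 0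
  simultaneously.\<close>

lemma compact_operator_imp_berezin_vanishes:
  assumes "compact_operator T"
  shows "((\<lambda>x. cinner (T (g x)) (f x)) \<longlongrightarrow> 0) (filtercomap (\<lambda>x. dist x 0) at_top)"
proof (rule tendstoI)
  fix e :: real assume "e > 0"
  define a where "a = A + 1"
  have "a > 0" using A_nonneg by (simp add: a_def)
  \<comment> \<open>The scaling by \<open>a\<close> puts \<open>g x\<close> into the unit ball, and
    \<open>f x\<close> costs another \<open>a\<close>; the error and the main term then contribute
    \<open>e / 2\<close> each.\<close>
  define d where "d = e / (2 * a\<^sup>2)"
  have "d > 0" using \<open>e > 0\<close> \<open>a > 0\<close> by (simp add: d_def)
  have T: "bounded_linear T" and "compact (closure (T ` cball 0 1))"
    using assms by (auto simp: compact_operator_def bounded_operators_def)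
  then obtain k where "finite k" and k: "closure (T ` cball 0 1) \<subseteq> (\<Union>u\<in>k. ball u d)"
    using \<open>d > 0\<close> unfolding compact_eq_totally_bounded by blast
  have "\<forall>\<^sub>F x in filtercomap (\<lambda>x. dist x 0) at_top. \<forall>u\<in>k. cmod (cinner u (f x)) < e / (2 * a)"
    using tendstoD[OF f_weakly_null, of "e / (2 * a)"] \<open>e > 0\<close> \<open>a > 0\<close>
    by (intro eventually_ball_finite \<open>finite k\<close>) simp
  then show "\<forall>\<^sub>F x in filtercomap (\<lambda>x. dist x 0) at_top. dist (cinner (T (g x)) (f x)) 0 < e"
  proof eventually_elim
    case (elim x)
    define v where "v = (1 / a) *\<^sub>R g x"
    have v: "T (g x) = a *\<^sub>R T v"
      using \<open>a > 0\<close> by (simp add: v_def linear_scale[OF bounded_linear.linear[OF T]])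
    have "norm v \<le> 1" using norm_g[of x] \<open>a > 0\<close> by (simp add: v_def a_def)
    then have "T v \<in> closure (T ` cball 0 1)" using closure_subset by fastforce
    then obtain u where u: "u \<in> k" "norm (T v - u) < d"
      using k by (force simp: dist_norm norm_minus_commute)
    have "cmod (cinner (T v - u) (f x)) \<le> norm (T v - u) * norm (f x)" by (rule cinner_bound)
    also have "\<dots> \<le> d * a" using u(2) norm_f[of x] by (intro mult_mono) (use \<open>d > 0\<close> in \<open>auto simp: a_def\<close>)
    finally have "cmod (cinner (T v) (f x) - cinner u (f x)) \<le> d * a" by (simp add: cinner.diff_left)
    moreover have "cmod (cinner u (f x)) < e / (2 * a)" using elim u(1) by blast
    ultimately have "cmod (cinner (T v) (f x)) < d * a + e / (2 * a)"
      using norm_triangle_ineq2[of "cinner (T v) (f x)" "cinner u (f x)"] by linarith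
    also have "\<dots> = e / a" using \<open>a > 0\<close> by (simp add: d_def power2_eq_square field_simps)
    finally have "a * cmod (cinner (T v) (f x)) < e" using \<open>a > 0\<close> by (simp add: field_simps)
    then show ?case using \<open>a > 0\<close> by (simp add: v cinner_scaleR_left)
  qed
qed

end

section \<open>Kernel estimates\<close>

text \<open>The product \<open>a x * b y\<close> is split by the weighted inequality
  \<open>2 a b <= a^2 p(y)/p(x) + b^2 p(x)/p(y)\<close>. The first term is integrated over
  \<open>y\<close> by \<open>rows\<close>, the second, after Tonelli, over \<open>x\<close> by
  \<open>columns\<close>; in both the weight cancels.\<close>

lemma schur_test:
  fixes \<kappa> :: "'a \<Rightarrow> 'a \<Rightarrow> real"
  assumes "sigma_finite_measure M"
    and \<kappa>[measurable]: "(\<lambda>(x, y). \<kappa> x y) \<in> borel_measurable (M \<Otimes>\<^sub>M M)" and \<kappa>_nonneg: "\<And>x y. 0 \<le> \<kappa> x y"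
    and p[measurable]: "p \<in> borel_measurable M" and p_pos: "\<And>x. 0 < p x"
    and [measurable]: "a \<in> borel_measurable M" "b \<in> borel_measurable M"
    and rows: "\<And>x. (\<integral>\<^sup>+y. ennreal (\<kappa> x y * p y) \<partial>M) \<le> ennreal (\<epsilon> * p x)"
    and columns: "\<And>y. (\<integral>\<^sup>+x. ennreal (\<kappa> x y * p x) \<partial>M) \<le> ennreal (\<epsilon> * p y)"
    and "0 \<le> \<epsilon>"
    and a: "(\<integral>\<^sup>+x. ennreal ((a x)\<^sup>2) \<partial>M) \<le> ennreal \<alpha>" and "0 \<le> \<alpha>"
    and b: "(\<integral>\<^sup>+x. ennreal ((b x)\<^sup>2) \<partial>M) \<le> ennreal \<alpha>"
  shows "(\<integral>\<^sup>+x. \<integral>\<^sup>+y. ennreal (a x * \<kappa> x y * b y) \<partial>M \<partial>M) \<le> ennreal (\<epsilon> * \<alpha>)"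
proof -
  interpret sigma_finite_measure M by (rule assms(1))
  interpret pair_sigma_finite M M by unfold_locales
  have \<kappa>'[measurable]: "(\<lambda>x. \<kappa> (fst x) (snd x)) \<in> borel_measurable (M \<Otimes>\<^sub>M M)"
    using \<kappa> by (simp add: case_prod_beta')
  have nonneg: "0 \<le> \<epsilon> * \<alpha>" using \<open>0 \<le> \<epsilon>\<close> \<open>0 \<le> \<alpha>\<close> by (rule mult_nonneg_nonneg)
  \<comment> \<open>Stated for a general kernel because it is used for \<open>\<kappa>\<close> and
    for its transpose.\<close>
  have half: "(\<integral>\<^sup>+x. \<integral>\<^sup>+y. ennreal ((c x)\<^sup>2 / p x) * ennreal (\<theta> x y * p y) \<partial>M \<partial>M) \<le> ennreal (\<epsilon> * \<alpha>)"
    if [measurable]: "c \<in> borel_measurable M" "(\<lambda>x. \<theta> (fst x) (snd x)) \<in> borel_measurable (M \<Otimes>\<^sub>M M)"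
      and \<theta>: "\<And>x. (\<integral>\<^sup>+y. ennreal (\<theta> x y * p y) \<partial>M) \<le> ennreal (\<epsilon> * p x)"
      and c: "(\<integral>\<^sup>+x. ennreal ((c x)\<^sup>2) \<partial>M) \<le> ennreal \<alpha>" for c \<theta>
  proof -
    have "(\<integral>\<^sup>+x. \<integral>\<^sup>+y. ennreal ((c x)\<^sup>2 / p x) * ennreal (\<theta> x y * p y) \<partial>M \<partial>M)
        \<le> (\<integral>\<^sup>+x. ennreal \<epsilon> * ennreal ((c x)\<^sup>2) \<partial>M)"
    proof (rule nn_integral_mono)
      fix x assume [measurable]: "x \<in> space M"
      have [measurable]: "(\<lambda>y. \<theta> x y) \<in> borel_measurable M"
        using measurable_compose[OF measurable_Pair1'[of x M M] that(2)] \<open>x \<in> space M\<close> by simp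
      have "(\<integral>\<^sup>+y. ennreal ((c x)\<^sup>2 / p x) * ennreal (\<theta> x y * p y) \<partial>M)
          = ennreal ((c x)\<^sup>2 / p x) * (\<integral>\<^sup>+y. ennreal (\<theta> x y * p y) \<partial>M)"
        by (rule nn_integral_cmult) measurable
      also have "\<dots> \<le> ennreal ((c x)\<^sup>2 / p x) * ennreal (\<epsilon> * p x)"
        by (intro mult_left_mono \<theta>) simp
      also have "\<dots> = ennreal ((c x)\<^sup>2 / p x * (\<epsilon> * p x))"
        using p_pos[of x] by (intro ennreal_mult'[symmetric] divide_nonneg_pos) simp_all
      also have "(c x)\<^sup>2 / p x * (\<epsilon> * p x) = \<epsilon> * (c x)\<^sup>2" using p_pos[of x] by simp
      also have "ennreal (\<epsilon> * (c x)\<^sup>2) = ennreal \<epsilon> * ennreal ((c x)\<^sup>2)"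
        using \<open>0 \<le> \<epsilon>\<close> by (rule ennreal_mult')
      finally show "(\<integral>\<^sup>+y. ennreal ((c x)\<^sup>2 / p x) * ennreal (\<theta> x y * p y) \<partial>M) \<le> ennreal \<epsilon> * ennreal ((c x)\<^sup>2)" .
    qed
    also have "\<dots> = ennreal \<epsilon> * (\<integral>\<^sup>+x. ennreal ((c x)\<^sup>2) \<partial>M)" by (rule nn_integral_cmult) measurable
    also have "\<dots> \<le> ennreal \<epsilon> * ennreal \<alpha>" by (intro mult_left_mono c) simp
    also have "\<dots> = ennreal (\<epsilon> * \<alpha>)" using \<open>0 \<le> \<epsilon>\<close> by (rule ennreal_mult'[symmetric])
    finally show ?thesis .
  qed
  define P where "P x y = ennreal ((a x)\<^sup>2 / p x) * ennreal (\<kappa> x y * p y)" for x y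
  define Q where "Q x y = ennreal ((b y)\<^sup>2 / p y) * ennreal (\<kappa> x y * p x)" for x y
  have [measurable]: "(\<lambda>x. P (fst x) (snd x)) \<in> borel_measurable (M \<Otimes>\<^sub>M M)"
    "(\<lambda>x. Q (fst x) (snd x)) \<in> borel_measurable (M \<Otimes>\<^sub>M M)"
    unfolding P_def Q_def by measurable
  have [measurable]: "P x \<in> borel_measurable M" "Q x \<in> borel_measurable M" if "x \<in> space M" for x
    using measurable_compose[OF measurable_Pair1'[of x M M], of "\<lambda>x. P (fst x) (snd x)"]
      measurable_compose[OF measurable_Pair1'[of x M M], of "\<lambda>x. Q (fst x) (snd x)"] that by simp_all
  have "(\<integral>\<^sup>+x. \<integral>\<^sup>+y. Q x y \<partial>M \<partial>M) = (\<integral>\<^sup>+y. \<integral>\<^sup>+x. Q x y \<partial>M \<partial>M)"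
    by (rule Fubini'[symmetric]) (simp add: case_prod_beta')
  also have "\<dots> \<le> ennreal (\<epsilon> * \<alpha>)"
    unfolding Q_def
  proof (rule half[of b "\<lambda>y x. \<kappa> x y"])
    show "(\<lambda>x. \<kappa> (snd x) (fst x)) \<in> borel_measurable (M \<Otimes>\<^sub>M M)"
      using measurable_compose[OF measurable_pair_swap' \<kappa>] by (simp add: case_prod_beta')
  qed (use columns b in auto)
  finally have Q: "(\<integral>\<^sup>+x. \<integral>\<^sup>+y. Q x y \<partial>M \<partial>M) \<le> ennreal (\<epsilon> * \<alpha>)" .
  have P: "(\<integral>\<^sup>+x. \<integral>\<^sup>+y. P x y \<partial>M \<partial>M) \<le> ennreal (\<epsilon> * \<alpha>)"
    unfolding P_def by (rule half[of a \<kappa>]) (use rows a in auto)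
  have "(\<integral>\<^sup>+x. \<integral>\<^sup>+y. ennreal (a x * \<kappa> x y * b y) \<partial>M \<partial>M)
      \<le> (\<integral>\<^sup>+x. \<integral>\<^sup>+y. ennreal (1/2) * (P x y + Q x y) \<partial>M \<partial>M)"
  proof (intro nn_integral_mono)
    fix x y
    define t where "t = p y / p x"
    have "t > 0" using p_pos by (simp add: t_def)
    have "0 \<le> (a x * t - b y)\<^sup>2 / t" using \<open>t > 0\<close> by simp
    also have "\<dots> = (a x)\<^sup>2 * t + (b y)\<^sup>2 / t - 2 * (a x * b y)"
      using \<open>t > 0\<close> by (simp add: power2_eq_square field_simps)
    finally have "a x * b y \<le> 1/2 * ((a x)\<^sup>2 * t + (b y)\<^sup>2 / t)" by simp
    then have "\<kappa> x y * (a x * b y) \<le> \<kappa> x y * (1/2 * ((a x)\<^sup>2 * t + (b y)\<^sup>2 / t))"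
      by (rule mult_left_mono[OF _ \<kappa>_nonneg])
    then have "a x * \<kappa> x y * b y
        \<le> 1/2 * ((a x)\<^sup>2 / p x * (\<kappa> x y * p y) + (b y)\<^sup>2 / p y * (\<kappa> x y * p x))"
      by (simp add: t_def algebra_simps)
    then have "ennreal (a x * \<kappa> x y * b y)
        \<le> ennreal (1/2 * ((a x)\<^sup>2 / p x * (\<kappa> x y * p y) + (b y)\<^sup>2 / p y * (\<kappa> x y * p x)))"
      by (rule ennreal_leI)
    also have "\<dots> = ennreal (1/2) * (P x y + Q x y)"
      unfolding P_def Q_def
      using p_pos[of x] p_pos[of y] \<kappa>_nonneg[of x y]
      by (subst (1 2) ennreal_mult'[symmetric], simp, simp, subst ennreal_plus[symmetric])
        (simp_all only: ennreal_mult'[symmetric] zero_le_divide_1_iff zero_le_numeral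
          mult_nonneg_nonneg divide_nonneg_pos zero_le_power2 less_imp_le)
    finally show "ennreal (a x * \<kappa> x y * b y) \<le> ennreal (1/2) * (P x y + Q x y)" .
  qed
  also have "\<dots> = (\<integral>\<^sup>+x. ennreal (1/2) * ((\<integral>\<^sup>+y. P x y \<partial>M) + (\<integral>\<^sup>+y. Q x y \<partial>M)) \<partial>M)"
    by (intro nn_integral_cong) (simp add: nn_integral_cmult nn_integral_add)
  also have "\<dots> = ennreal (1/2) * ((\<integral>\<^sup>+x. \<integral>\<^sup>+y. P x y \<partial>M \<partial>M) + (\<integral>\<^sup>+x. \<integral>\<^sup>+y. Q x y \<partial>M \<partial>M))"
    by (simp add: nn_integral_cmult nn_integral_add)
  also have "\<dots> \<le> ennreal (1/2) * (ennreal (\<epsilon> * \<alpha>) + ennreal (\<epsilon> * \<alpha>))"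
    by (intro mult_left_mono add_mono P Q) simp
  also have "\<dots> = ennreal (1/2 * (\<epsilon> * \<alpha> + \<epsilon> * \<alpha>))"
    unfolding ennreal_plus[OF nonneg nonneg, symmetric] by (rule ennreal_mult'[symmetric]) simp
  finally show ?thesis by (simp add: mult.commute)
qed

section \<open>Kernels of operators with respect to the two frames\<close>

context dual_frames
begin

lemma adjoint_exists:
  assumes "T \<in> bounded_operators"
  obtains U where "U \<in> bounded_operators" "\<And>v w. cinner (T v) w = cinner v (U (w :: 'h))"
proof -
  note lT = bounded_linear.linear[OF bounded_operatorsD(1)[OF assms]]
  obtain K where K: "K \<ge> 0" "\<And>v. norm (T v) \<le> norm v * K"
    using bounded_linear.nonneg_bounded[OF bounded_operatorsD(1)[OF assms]] by blast
  obtain U where U: "U \<in> bounded_operators" "\<And>v w. cinner (U v) w = cinner v (T w)"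
    "\<And>v. norm (U v) \<le> K * norm v"
  proof (rule sesquilinear_operator[of "\<lambda>v w. cinner v (T w)" K])
    show "cmod (cinner v (T w)) \<le> K" if "norm v \<le> 1" "norm w \<le> 1" for v w
    proof -
      have "cmod (cinner v (T w)) \<le> norm v * norm (T w)" by (rule cinner_bound)
      also have "\<dots> \<le> 1 * (1 * K)"
        using that K by (intro mult_mono order_trans[OF K(2)]) auto
      finally show ?thesis by simp
    qed
  qed (auto simp: cinner_add_left cinner_add_right cinner_scaleC_left cinner_scaleC_right
      linear_add[OF lT] bounded_operatorsD(2)[OF assms] intro: that)
  have "cinner (T v) w = cinner v (U w)" for v w
    by (subst (1 2) cinner_commute) (simp add: U(2))
  with U(1) show ?thesis using that by blast
qed

text \<open>The reproducing formula is applied twice, to \<open>v\<close> paired with the adjoint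
  image of \<open>w\<close>, and to \<open>T (g x)\<close> paired with \<open>w\<close>. Taking
  absolute values at each stage avoids any question about integrability of the double
  integral.\<close>

lemma kernel_bound:
  assumes "T \<in> bounded_operators"
  shows "ennreal (cmod (cinner (T v) w)) \<le>
    (\<integral>\<^sup>+x. \<integral>\<^sup>+y. ennreal (cmod (cinner v (f x)) * cmod (cinner (T (g x)) (f y)) * cmod (cinner w (g y))) \<partial>\<mu> \<partial>\<mu>)"
proof -
  obtain U where U: "\<And>v w. cinner (T v) w = cinner v (U w)"
    using adjoint_exists[OF assms] by metis
  have "cinner (T v) w = (\<integral>x. cinner v (f x) * cinner (T (g x)) w \<partial>\<mu>)"
    unfolding U by (rule reproducing)
  then have "ennreal (cmod (cinner (T v) w)) \<le> (\<integral>\<^sup>+x. ennreal (cmod (cinner v (f x) * cinner (T (g x)) w)) \<partial>\<mu>)"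
    using norm_integral_le_nn_integral by metis
  also have "\<dots> \<le> (\<integral>\<^sup>+x. \<integral>\<^sup>+y. ennreal (cmod (cinner v (f x)) * cmod (cinner (T (g x)) (f y)) * cmod (cinner w (g y))) \<partial>\<mu> \<partial>\<mu>)"
  proof (rule nn_integral_mono)
    fix x
    have "ennreal (cmod (cinner v (f x) * cinner (T (g x)) w))
        = ennreal (cmod (cinner v (f x))) * ennreal (cmod (\<integral>y. cinner (T (g x)) (f y) * cinner (g y) w \<partial>\<mu>))"
      by (simp add: norm_mult ennreal_mult flip: reproducing)
    also have "\<dots> \<le> ennreal (cmod (cinner v (f x))) *
        (\<integral>\<^sup>+y. ennreal (cmod (cinner (T (g x)) (f y) * cinner (g y) w)) \<partial>\<mu>)"
      by (intro mult_left_mono norm_integral_le_nn_integral) simp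
    also have "\<dots> = (\<integral>\<^sup>+y. ennreal (cmod (cinner v (f x))) * ennreal (cmod (cinner (T (g x)) (f y) * cinner (g y) w)) \<partial>\<mu>)"
      by (rule nn_integral_cmult[symmetric]) measurable
    also have "\<dots> = (\<integral>\<^sup>+y. ennreal (cmod (cinner v (f x)) * cmod (cinner (T (g x)) (f y)) * cmod (cinner w (g y))) \<partial>\<mu>)"
      by (intro nn_integral_cong)
        (simp add: norm_mult ennreal_mult mult.assoc cmod_cinner_commute[of w])
    finally show "ennreal (cmod (cinner v (f x) * cinner (T (g x)) w)) \<le> \<dots>" .
  qed
  finally show ?thesis .
qed

text \<open>A sequence violating the conclusion yields, as limit of the translates of \<open>T\<close>, an operator with
  vanishing Berezin transform but nonzero kernel.\<close>

lemma kernel_vanishes_at_infinity: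
  assumes T: "T \<in> bounded_operators"
    and inj: "\<And>T'. T' \<in> bounded_operators \<Longrightarrow> (\<And>x. cinner (T' (g x)) (f x) = 0) \<Longrightarrow> T' = (\<lambda>_. 0)"
    and vanish: "((\<lambda>x. cinner (T (g x)) (f x)) \<longlongrightarrow> 0) (filtercomap (\<lambda>x. dist x 0) at_top)"
    and "e > 0"
  obtains \<rho> where "\<And>x y. dist x 0 > \<rho> \<Longrightarrow> dist x y \<le> R \<Longrightarrow> cmod (cinner (T (g x)) (f y)) < e"
proof (rule ccontr)
  assume "\<not> thesis"
  then have "\<exists>x y. dist x 0 > real n \<and> dist x y \<le> R \<and> e \<le> cmod (cinner (T (g x)) (f y))" for n
    using that by (meson not_le)
  then obtain X Y where X: "\<And>n. dist (X n) 0 > real n" and XY: "\<And>n. dist (X n) (Y n) \<le> R"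
    and e: "\<And>n. e \<le> cmod (cinner (T (g (X n))) (f (Y n)))" by metis
  have "\<exists>V. V \<in> bounded_operators \<and> (\<forall>v. norm (V v) \<le> C * norm v) \<and> (\<forall>a. V (g a) = g (z + a))" for z
    using translation_operator[of z] by metis
  then obtain V where V: "\<And>z. V z \<in> bounded_operators" "\<And>z v. norm (V z v) \<le> C * norm v"
    "\<And>z a. V z (g a) = g (z + a)" by metis
  \<comment> \<open>The second argument of the kernel is a vector of \<open>f\<close>, whose
    translations come from the swapped locale.\<close>
  have "\<exists>W. W \<in> bounded_operators \<and> (\<forall>v. norm (W v) \<le> C * norm v) \<and> (\<forall>a. W (f a) = f (z + a))" for z
    using dual_frames.translation_operator[OF swapped, of z] by metis
  then obtain W where W: "\<And>z. W z \<in> bounded_operators" "\<And>z v. norm (W z v) \<le> C * norm v"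
    "\<And>z a. W z (f a) = f (z + a)" by metis
  obtain K where "K \<ge> 0" and K: "\<And>v. norm (T v) \<le> norm v * K"
    using bounded_linear.nonneg_bounded[OF bounded_operatorsD(1)[OF T]] by blast
  \<comment> \<open>The form of the translate of \<open>T\<close> by \<open>z\<close>; on frame
    vectors it is the kernel shifted by \<open>z\<close>, see \<open>F_kernel\<close>.\<close>
  define F where "F z v w = cinner (T (V z v)) (W z w)" for z v w
  define L where "L = C * K * C"
  have "L \<ge> 0" using C_pos \<open>K \<ge> 0\<close> by (simp add: L_def)
  note lin = bounded_linear.linear[OF bounded_operatorsD(1)]
  have F_add: "F z (u + v) w = F z u w + F z v w" "F z u (v + w) = F z u v + F z u w"
    and F_diff: "F z (u - v) w = F z u w - F z v w" "F z u (v - w) = F z u v - F z u w"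
    and F_scaleC: "F z (c *\<^sub>C u) v = c * F z u v" "F z u (c *\<^sub>C v) = cnj c * F z u v" for z u v w c
    by (simp_all add: F_def linear_add[OF lin] linear_diff[OF lin] bounded_operatorsD(2) T V(1) W(1)
        cinner.add_left cinner.add_right cinner.diff_left cinner.diff_right
        cinner_scaleC_left cinner_scaleC_right)
  have F_bound: "cmod (F z v w) \<le> L * (norm v * norm w)" for z v w
  proof -
    have "cmod (F z v w) \<le> norm (T (V z v)) * norm (W z w)" unfolding F_def by (rule cinner_bound)
    also have "\<dots> \<le> ((C * norm v) * K) * (C * norm w)"
      using C_pos \<open>K \<ge> 0\<close> by (intro mult_mono order_trans[OF K] V(2) W(2)) auto
    finally show ?thesis by (simp add: L_def mult_ac)
  qed
  have F_kernel: "F z (g a) (f b) = cinner (T (g (z + a))) (f (z + b))" for z a b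
    by (simp add: F_def V(3) W(3))
  \<comment> \<open>One subsequence must serve all pairs of vectors, hence the extraction on the
    product space.\<close>
  obtain k :: "nat \<Rightarrow> nat" where "strict_mono k"
    and k: "\<And>vw. convergent (\<lambda>n. F (X (k n)) (fst vw) (snd vw))"
  proof (rule equicontinuous_convergent_subsequence[of "\<lambda>n vw. F (X n) (fst vw) (snd vw)"
        "\<lambda>vw. L * (norm (fst vw) * norm (snd vw))"])
    fix x :: "'h \<times> 'h" and e :: real assume "e > 0"
    \<comment> \<open>A strict Lipschitz constant near \<open>x\<close>: \<open>d \<le> 1\<close>
      lets \<open>norm v'\<close> be replaced by \<open>norm v + 1\<close>, and \<open>L + 1\<close>
      in place of \<open>L\<close> gives strictness.\<close>
    define N where "N = (L + 1) * (norm (fst x) + norm (snd x) + 1)"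
    have "N > 0" using \<open>L \<ge> 0\<close> by (simp add: N_def add_nonneg_pos)
    define d where "d = min 1 (e / N)"
    have "d > 0" "d \<le> 1" using \<open>e > 0\<close> \<open>N > 0\<close> by (auto simp: d_def)
    have "d * N \<le> e" using \<open>N > 0\<close> by (simp add: d_def min_def field_simps)
    have "cmod (F z (fst x) (snd x) - F z (fst y) (snd y)) < e" if "dist x y < d" for z y
    proof -
      obtain v w v' w' where xy: "x = (v, w)" "y = (v', w')" by (metis prod.exhaust)
      have v: "norm (v - v') < d" and w: "norm (w - w') < d"
        using that dist_fst_le[of x y] dist_snd_le[of x y] by (auto simp: xy dist_norm)
      have "norm v' \<le> norm v + 1"
        using v \<open>d \<le> 1\<close> norm_triangle_ineq2[of v' v] by (simp add: norm_minus_commute)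
      have "F z v w - F z v' w' = F z (v - v') w + F z v' (w - w')" by (simp add: F_diff)
      also have "cmod \<dots> \<le> L * (norm (v - v') * norm w) + L * (norm v' * norm (w - w'))"
        by (intro norm_triangle_le add_mono F_bound)
      also have "\<dots> \<le> L * (d * norm w) + L * ((norm v + 1) * d)"
        using v w \<open>L \<ge> 0\<close> \<open>norm v' \<le> norm v + 1\<close>
        by (intro add_mono mult_left_mono mult_right_mono mult_mono) auto
      also have "\<dots> = d * (L * (norm v + norm w + 1))" by (simp add: algebra_simps)
      also have "\<dots> < d * N"
        using \<open>d > 0\<close> by (auto simp: N_def xy add_nonneg_pos intro!: mult_strict_left_mono mult_strict_right_mono)
      finally show ?thesis using \<open>d * N \<le> e\<close> by (simp add: xy)
    qed
    then show "\<exists>d>0. \<forall>n y. dist x y < d \<longrightarrow>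
        cmod (F (X n) (fst x) (snd x) - F (X n) (fst y) (snd y)) < e"
      using \<open>d > 0\<close> by blast
  qed (use F_bound in auto)
  define l where "l v w = lim (\<lambda>n. F (X (k n)) v w)" for v w
  have l: "(\<lambda>n. F (X (k n)) v w) \<longlonglongrightarrow> l v w" for v w
    using k[of "(v, w)"] unfolding l_def by (simp add: convergent_LIMSEQ_iff)
  obtain T' where T': "T' \<in> bounded_operators" "\<And>v w. cinner (T' v) w = l v w"
  proof (rule sesquilinear_operator[of l L])
    show "l (u + v) w = l u w + l v w" for u v w
      using l[of "u + v" w] tendsto_add[OF l[of u w] l[of v w]] by (simp add: F_add LIMSEQ_unique)
    show "l u (v + w) = l u v + l u w" for u v w
      using l[of u "v + w"] tendsto_add[OF l[of u v] l[of u w]] by (simp add: F_add LIMSEQ_unique)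
    show "l (c *\<^sub>C v) w = c * l v w" for c v w
      using l[of "c *\<^sub>C v" w] tendsto_mult_left[OF l[of v w], of c] by (simp add: F_scaleC LIMSEQ_unique)
    show "l v (c *\<^sub>C w) = cnj c * l v w" for c v w
      using l[of v "c *\<^sub>C w"] tendsto_mult_left[OF l[of v w], of "cnj c"] by (simp add: F_scaleC LIMSEQ_unique)
    show "cmod (l v w) \<le> L" if "norm v \<le> 1" "norm w \<le> 1" for v w
    proof -
      have "L * (norm v * norm w) \<le> L * 1"
        using that \<open>L \<ge> 0\<close> by (intro mult_left_mono mult_le_one) auto
      then have "cmod (F z v w) \<le> L" for z using F_bound[of z v w] by simp
      then show ?thesis by (intro LIMSEQ_le_const2[OF tendsto_norm[OF l]]) auto
    qed
  qed (rule that)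
  have "cinner (T' (g a)) (f a) = 0" for a
  proof -
    \<comment> \<open>Right translation by \<open>a\<close> moves every point by the fixed distance
      \<open>dist 0 a\<close>, by left invariance, so these points still go to infinity.\<close>
    have "filterlim (\<lambda>n. X (k n) + a) (filtercomap (\<lambda>x. dist x 0) at_top) sequentially"
      unfolding filterlim_filtercomap_iff o_def filterlim_at_top
    proof
      fix Z :: real
      obtain N where N: "Z + dist 0 a \<le> real N" using real_arch_simple by blast
      have "Z \<le> dist (X (k n) + a) 0" if "n \<ge> N" for n
      proof -
        have "N \<le> k n" using seq_suble[OF \<open>strict_mono k\<close>, of n] \<open>n \<ge> N\<close> by simp
        have "dist (X (k n)) (X (k n) + a) = dist (X (k n) + 0) (X (k n) + a)" by simp
        also have "\<dots> = dist 0 a"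
          using left_invariant unfolding left_invariant_metric_def by blast
        finally have "dist (X (k n)) (X (k n) + a) = dist 0 a" .
        then show ?thesis
          using X[of "k n"] N \<open>N \<le> k n\<close> dist_triangle[of "X (k n)" 0 "X (k n) + a"] by linarith
      qed
      then show "\<forall>\<^sub>F n in sequentially. Z \<le> dist (X (k n) + a) 0"
        by (auto simp: eventually_sequentially)
    qed
    with vanish have "(\<lambda>n. cinner (T (g (X (k n) + a))) (f (X (k n) + a))) \<longlonglongrightarrow> 0"
      by (rule filterlim_compose)
    then show ?thesis
      using l[of "g a" "f a"] by (simp add: T'(2) F_kernel LIMSEQ_unique)
  qed
  then have "T' = (\<lambda>_. 0)" using inj T'(1) by blast
  then have l0: "(\<lambda>n. F (X (k n)) v w) \<longlonglongrightarrow> 0" for v w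
    using l[of v w] T'(2)[of v w] by (simp add: cinner.zero_left)
  \<comment> \<open>The positions of \<open>Y n\<close> relative to \<open>X n\<close> lie in a
    compact ball; along a further subsequence they converge to some \<open>u\<close>, so the kernel
    at \<open>(X n, Y n)\<close> is compared with the form at the fixed pair \<open>g 0\<close>,
    \<open>f u\<close>.\<close>
  define U where "U n = - X n + Y n" for n
  have U: "X n + U n = Y n" for n by (simp add: U_def add.assoc[symmetric])
  have "U n \<in> cball 0 R" for n
  proof -
    have "dist 0 (U n) = dist (X n + 0) (X n + U n)"
      using left_invariant unfolding left_invariant_metric_def by metis
    then show ?thesis using XY[of n] by (simp add: U)
  qed
  moreover have "compact (cball (0::'g) R)" using proper by (simp add: proper_metric_def)
  ultimately have "\<exists>u\<in>cball 0 R. \<exists>r. strict_mono r \<and> ((U \<circ> k) \<circ> r) \<longlonglongrightarrow> u"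
    using compact_imp_seq_compact[of "cball 0 R"] unfolding seq_compact_def by (metis comp_apply)
  then obtain r u where "strict_mono r" and u: "(\<lambda>n. U (k (r n))) \<longlonglongrightarrow> u"
    by (auto simp: o_def)
  have "(\<lambda>n. norm (f (U (k (r n))) - f u)) \<longlonglongrightarrow> 0"
    using continuous_on_tendsto_compose[OF continuous_f u] by (simp add: LIM_zero tendsto_norm_zero_iff)
  moreover have "(\<lambda>n. cmod (F (X (k (r n))) (g 0) (f u))) \<longlonglongrightarrow> 0"
    using LIMSEQ_subseq_LIMSEQ[OF l0 \<open>strict_mono r\<close>, of "g 0" "f u"]
    by (intro tendsto_norm_zero) (simp add: o_def)
  ultimately have "(\<lambda>n. cmod (F (X (k (r n))) (g 0) (f u)) + L * (norm (g 0) * norm (f (U (k (r n))) - f u)))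
      \<longlonglongrightarrow> 0 + L * (norm (g 0) * 0)"
    by (intro tendsto_add tendsto_mult tendsto_const)
  moreover have "e \<le> cmod (F (X n) (g 0) (f u)) + L * (norm (g 0) * norm (f (U n) - f u))" for n :: nat
  proof -
    have "e \<le> cmod (F (X n) (g 0) (f (U n)))" using e[of n] by (simp add: F_kernel U)
    also have "F (X n) (g 0) (f (U n)) = F (X n) (g 0) (f u) + F (X n) (g 0) (f (U n) - f u)"
      by (simp add: F_diff)
    also have "cmod \<dots> \<le> cmod (F (X n) (g 0) (f u)) + L * (norm (g 0) * norm (f (U n) - f u))"
      by (intro norm_triangle_le add_left_mono F_bound)
    finally show ?thesis .
  qed
  ultimately have "e \<le> 0 + L * (norm (g 0) * 0)" by (intro LIMSEQ_le_const) auto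
  with \<open>e > 0\<close> show False by simp
qed

section \<open>Localization and decay yield compactness\<close>

lemma sets_pair_haar: "sets (\<mu> \<Otimes>\<^sub>M \<mu>) = sets borel"
  using sets_pair_measure_cong[OF sets_haar_measure sets_haar_measure, OF haar haar]
  by (simp only: borel_prod)

lemma measurable_dist[measurable]: "(\<lambda>z. dist (fst z) (snd z)) \<in> borel_measurable (\<mu> \<Otimes>\<^sub>M \<mu>)"
  by (intro borel_measurable_continuous_on_UNIV[OF sets_pair_haar] continuous_intros)

lemma measurable_dist_0[measurable]: "(\<lambda>x. dist x 0) \<in> borel_measurable \<mu>"
  by (intro borel_measurable_continuous_on_UNIV[OF sets_haar_measure[OF haar]] continuous_intros)

lemma measurable_kernel:
  assumes "T \<in> bounded_operators"
  shows "(\<lambda>z. cmod (cinner (T (g (fst z))) (f (snd z)))) \<in> borel_measurable (\<mu> \<Otimes>\<^sub>M \<mu>)"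
  by (intro borel_measurable_continuous_on_UNIV[OF sets_pair_haar] continuous_on_norm cinner.continuous_on
      bounded_linear.continuous_on[OF bounded_operatorsD(1)[OF assms]]
      continuous_on_compose2[OF continuous_f] continuous_on_compose2[OF continuous_g] continuous_intros)
    auto

text \<open>The far part of the kernel is controlled by localization, the near part outside a large ball by
  the decay of the kernel; what remains is integrated over a compact set.\<close>

lemma norm_estimate:
  assumes T: "T \<in> bounded_operators"
    and p[measurable]: "p \<in> borel_measurable borel" and p_pos: "\<And>x. 0 < p x"
    and localized: "weakly_localized \<mu> p g f T"
    and decay: "\<And>\<delta> R. 0 < \<delta> \<Longrightarrow>
      \<exists>\<rho>. \<forall>x y. dist x 0 > \<rho> \<longrightarrow> dist x y \<le> R \<longrightarrow> cmod (cinner (T (g x)) (f y)) < \<delta>"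
    and "0 < e"
  obtains \<rho> L where "0 \<le> L" and "\<And>v. norm v \<le> 1 \<Longrightarrow>
    ennreal (norm (T v)) \<le> ennreal e + ennreal L * (\<integral>\<^sup>+x\<in>cball 0 \<rho>. ennreal (cmod (cinner v (f x))) \<partial>\<mu>)"
proof -
  interpret sigma_finite_measure \<mu> by (rule sigma_finite_haar)
  interpret pair_sigma_finite \<mu> \<mu> by unfold_locales
  define \<kappa> where "\<kappa> x y = cmod (cinner (T (g x)) (f y))" for x y
  \<comment> \<open>Two applications of the Schur test, each costing \<open>\<epsilon> * C\<close>,
    add up to \<open>e\<close>.\<close>
  define \<epsilon> where "\<epsilon> = e / (2 * C)"
  have "\<epsilon> > 0" using \<open>0 < e\<close> C_pos by (simp add: \<epsilon>_def)
  have p'[measurable]: "p \<in> borel_measurable \<mu>"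
    using p measurable_cong_sets[OF sets_haar_measure[OF haar] refl] by blast
  have \<kappa>_meas[measurable]: "(\<lambda>z. \<kappa> (fst z) (snd z)) \<in> borel_measurable (\<mu> \<Otimes>\<^sub>M \<mu>)"
    unfolding \<kappa>_def by (rule measurable_kernel[OF T])
  have "\<forall>\<^sub>F R::real in at_top. (SUP x. ennreal (1 / p x) *
        (\<integral>\<^sup>+y\<in>- cball x R. ennreal (\<kappa> x y * p y) \<partial>\<mu>)) < ennreal \<epsilon>"
    "\<forall>\<^sub>F R::real in at_top. (SUP y. ennreal (1 / p y) *
        (\<integral>\<^sup>+x\<in>- cball y R. ennreal (\<kappa> x y * p x) \<partial>\<mu>)) < ennreal \<epsilon>"
    using localized \<open>\<epsilon> > 0\<close> unfolding weakly_localized_def \<kappa>_def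
    by (auto intro!: order_tendstoD(2)[where y = 0])
  then have "\<forall>\<^sub>F R::real in at_top. (SUP x. ennreal (1 / p x) *
        (\<integral>\<^sup>+y\<in>- cball x R. ennreal (\<kappa> x y * p y) \<partial>\<mu>)) < ennreal \<epsilon> \<and>
      (SUP y. ennreal (1 / p y) *
        (\<integral>\<^sup>+x\<in>- cball y R. ennreal (\<kappa> x y * p x) \<partial>\<mu>)) < ennreal \<epsilon>"
    by (rule eventually_conj)
  then obtain R :: real where
    R1: "(SUP x. ennreal (1 / p x) * (\<integral>\<^sup>+y\<in>- cball x R. ennreal (\<kappa> x y * p y) \<partial>\<mu>)) < ennreal \<epsilon>"
    and R2: "(SUP y. ennreal (1 / p y) * (\<integral>\<^sup>+x\<in>- cball y R. ennreal (\<kappa> x y * p x) \<partial>\<mu>)) < ennreal \<epsilon>"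
    using eventually_happens'[OF trivial_limit_at_top_linorder] by blast
  have mult_p: "I \<le> ennreal (\<epsilon> * p x)" if "ennreal (1 / p x) * I < ennreal \<epsilon>" for I x
  proof -
    have "I = ennreal (p x) * (ennreal (1 / p x) * I)"
      using p_pos[of x] by (simp add: mult.assoc[symmetric] ennreal_mult'[symmetric])
    also have "\<dots> \<le> ennreal (p x) * ennreal \<epsilon>" using that by (intro mult_left_mono) auto
    also have "\<dots> = ennreal (p x * \<epsilon>)"
      using p_pos[of x] by (intro ennreal_mult'[symmetric]) simp
    finally show ?thesis by (simp add: mult.commute)
  qed
  define m where "m = measure \<mu> (cball 0 R)"
  have m: "emeasure \<mu> (cball x R) = ennreal m" for x
    unfolding emeasure_cball_translation[OF haar left_invariant, of x] m_def
    using emeasure_cball_finite[of 0 R] by (simp add: emeasure_eq_ennreal_measure less_top)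
  have "m \<ge> 0" by (simp add: m_def)
  \<comment> \<open>A near row has support of measure at most \<open>m\<close> and entries below
    \<open>\<delta>\<close>, so its integral is at most
    \<open>\<delta> * m \<le> \<epsilon>\<close>.\<close>
  define \<delta> where "\<delta> = \<epsilon> / (m + 1)"
  have "\<delta> > 0" using \<open>\<epsilon> > 0\<close> \<open>m \<ge> 0\<close> by (simp add: \<delta>_def)
  have "\<delta> * m \<le> \<epsilon>" using \<open>\<epsilon> > 0\<close> \<open>m \<ge> 0\<close> by (simp add: \<delta>_def field_simps)
  obtain \<rho> where \<rho>: "\<And>x y. dist x 0 > \<rho> \<Longrightarrow> dist x y \<le> R \<Longrightarrow> \<kappa> x y < \<delta>"
    using decay[OF \<open>\<delta> > 0\<close>] unfolding \<kappa>_def by metis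
  obtain K where "K \<ge> 0" and K: "\<And>v. norm (T v) \<le> norm v * K"
    using bounded_linear.nonneg_bounded[OF bounded_operatorsD(1)[OF T]] by blast
  have \<kappa>_bound: "\<kappa> x y \<le> A * K * A" for x y
  proof -
    have "\<kappa> x y \<le> norm (T (g x)) * norm (f y)" unfolding \<kappa>_def by (rule cinner_bound)
    also have "\<dots> \<le> (A * K) * A"
      using A_nonneg \<open>K \<ge> 0\<close>
      by (intro mult_mono order_trans[OF K] norm_f norm_g mult_right_mono) auto
    finally show ?thesis .
  qed
  define far where "far x y = (if dist x y \<le> R then 0 else \<kappa> x y)" for x y
  define outer where "outer x y = (if dist x y \<le> R \<and> \<rho> < dist x 0 then \<kappa> x y else 0)" for x y
  define inner where "inner x y = (if dist x y \<le> R \<and> dist x 0 \<le> \<rho> then \<kappa> x y else 0)" for x y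
  have [measurable]: "(\<lambda>z. far (fst z) (snd z)) \<in> borel_measurable (\<mu> \<Otimes>\<^sub>M \<mu>)"
    "(\<lambda>z. outer (fst z) (snd z)) \<in> borel_measurable (\<mu> \<Otimes>\<^sub>M \<mu>)"
    "(\<lambda>z. inner (fst z) (snd z)) \<in> borel_measurable (\<mu> \<Otimes>\<^sub>M \<mu>)"
    unfolding far_def outer_def inner_def by measurable
  have nonneg: "0 \<le> far x y" "0 \<le> outer x y" "0 \<le> inner x y" for x y
    by (simp_all add: far_def outer_def inner_def \<kappa>_def)
  have split: "\<kappa> x y = far x y + outer x y + inner x y" for x y
    by (auto simp: far_def outer_def inner_def)
  \<comment> \<open>The kernel is at most \<open>A * K * A\<close>, the factor \<open>b y\<close> at
    most \<open>A\<close>, and \<open>y\<close> ranges over a ball of measure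
    \<open>m\<close>.\<close>
  define L where "L = A * K * A * A * m"
  have "L \<ge> 0" using A_nonneg \<open>K \<ge> 0\<close> \<open>m \<ge> 0\<close> by (simp add: L_def)
  have "ennreal (norm (T v)) \<le> ennreal e + ennreal L * (\<integral>\<^sup>+x\<in>cball 0 \<rho>. ennreal (cmod (cinner v (f x))) \<partial>\<mu>)"
    if "norm v \<le> 1" for v
  proof -
    obtain w where "norm w \<le> 1" and w: "cmod (cinner (T v) w) = norm (T v)"
      using norm_attained by blast
    define a where "a x = cmod (cinner v (f x))" for x
    define b where "b y = cmod (cinner w (g y))" for y
    have [measurable]: "a \<in> borel_measurable \<mu>" "b \<in> borel_measurable \<mu>"
      unfolding a_def b_def by measurable
    have "C * (norm v)\<^sup>2 \<le> C * 1" "C * (norm w)\<^sup>2 \<le> C * 1"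
      using C_pos \<open>norm v \<le> 1\<close> \<open>norm w \<le> 1\<close> by (intro mult_left_mono power_le_one; simp)+
    then have a2: "(\<integral>\<^sup>+x. ennreal ((a x)\<^sup>2) \<partial>\<mu>) \<le> ennreal C" and b2: "(\<integral>\<^sup>+x. ennreal ((b x)\<^sup>2) \<partial>\<mu>) \<le> ennreal C"
      using bessel_f[of v] bessel_g[of w] unfolding a_def b_def
      by (auto intro: order_trans ennreal_leI)
    have ab: "0 \<le> a x" "0 \<le> b x" "b x \<le> A" for x
    proof -
      have "b x \<le> norm w * norm (g x)" unfolding b_def by (rule cinner_bound)
      also have "\<dots> \<le> 1 * A" using \<open>norm w \<le> 1\<close> norm_g by (intro mult_mono) auto
      finally show "b x \<le> A" by simp
    qed (simp_all add: a_def b_def)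
    define I where "I \<theta> = (\<integral>\<^sup>+x. \<integral>\<^sup>+y. ennreal (a x * \<theta> x y * b y) \<partial>\<mu> \<partial>\<mu>)" for \<theta>
    have I_far: "I far \<le> ennreal (\<epsilon> * C)"
      unfolding I_def
    proof (rule schur_test[OF sigma_finite_haar, where p = p])
      show "(\<integral>\<^sup>+y. ennreal (far x y * p y) \<partial>\<mu>) \<le> ennreal (\<epsilon> * p x)" for x
      proof -
        have "(\<integral>\<^sup>+y. ennreal (far x y * p y) \<partial>\<mu>) = (\<integral>\<^sup>+y\<in>- cball x R. ennreal (\<kappa> x y * p y) \<partial>\<mu>)"
          by (intro nn_integral_cong) (auto simp: far_def indicator_def)
        also have "\<dots> \<le> ennreal (\<epsilon> * p x)"
          using le_less_trans[OF SUP_upper[OF UNIV_I] R1] by (intro mult_p) blast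
        finally show ?thesis .
      qed
      show "(\<integral>\<^sup>+x. ennreal (far x y * p x) \<partial>\<mu>) \<le> ennreal (\<epsilon> * p y)" for y
      proof -
        have "(\<integral>\<^sup>+x. ennreal (far x y * p x) \<partial>\<mu>) = (\<integral>\<^sup>+x\<in>- cball y R. ennreal (\<kappa> x y * p x) \<partial>\<mu>)"
          by (intro nn_integral_cong) (auto simp: far_def indicator_def dist_commute)
        also have "\<dots> \<le> ennreal (\<epsilon> * p y)"
          using le_less_trans[OF SUP_upper[OF UNIV_I] R2] by (intro mult_p) blast
        finally show ?thesis .
      qed
    qed (use nonneg p_pos a2 b2 \<open>\<epsilon> > 0\<close> C_pos in \<open>simp_all add: case_prod_beta'\<close>)
    have I_outer: "I outer \<le> ennreal (\<epsilon> * C)"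
      unfolding I_def
    proof (rule schur_test[OF sigma_finite_haar, where p = "\<lambda>_. 1"])
      have ball: "(\<integral>\<^sup>+x. ennreal \<delta> * indicator (cball y R) x \<partial>\<mu>) \<le> ennreal \<epsilon>" for y
      proof -
        have "(\<integral>\<^sup>+x. ennreal \<delta> * indicator (cball y R) x \<partial>\<mu>) = ennreal \<delta> * ennreal m"
          by (subst nn_integral_cmult_indicator) (simp_all add: m sets_haar_measure[OF haar])
        also have "\<dots> \<le> ennreal \<epsilon>"
          using \<open>\<delta> * m \<le> \<epsilon>\<close> \<open>\<delta> > 0\<close> by (simp add: ennreal_mult'[symmetric] ennreal_leI)
        finally show ?thesis .
      qed
      have le: "ennreal (outer x y * 1) \<le> ennreal \<delta> * indicator (cball x R) y"
        "ennreal (outer x y * 1) \<le> ennreal \<delta> * indicator (cball y R) x" for x y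
        using \<rho>[of x y] by (auto simp: outer_def indicator_def dist_commute intro!: ennreal_leI)
      show "(\<integral>\<^sup>+y. ennreal (outer x y * 1) \<partial>\<mu>) \<le> ennreal (\<epsilon> * 1)" for x
        using order_trans[OF nn_integral_mono[OF le(1)] ball] by simp
      show "(\<integral>\<^sup>+x. ennreal (outer x y * 1) \<partial>\<mu>) \<le> ennreal (\<epsilon> * 1)" for y
        using order_trans[OF nn_integral_mono[OF le(2)] ball] by simp
    qed (use nonneg a2 b2 \<open>\<epsilon> > 0\<close> C_pos in \<open>simp_all add: case_prod_beta'\<close>)
    have I_inner: "I inner \<le> ennreal L * (\<integral>\<^sup>+x\<in>cball 0 \<rho>. ennreal (a x) \<partial>\<mu>)"
    proof -
      have "I inner \<le> (\<integral>\<^sup>+x. ennreal L * (ennreal (a x) * indicator (cball 0 \<rho>) x) \<partial>\<mu>)"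
        unfolding I_def
      proof (rule nn_integral_mono)
        fix x
        define c where "c = A * K * A * A * (a x * indicator (cball 0 \<rho>) x)"
        have "c \<ge> 0" using A_nonneg \<open>K \<ge> 0\<close> ab(1)[of x] by (simp add: c_def)
        have "(\<integral>\<^sup>+y. ennreal (a x * inner x y * b y) \<partial>\<mu>) \<le> (\<integral>\<^sup>+y. ennreal c * indicator (cball x R) y \<partial>\<mu>)"
        proof (rule nn_integral_mono)
          fix y
          show "ennreal (a x * inner x y * b y) \<le> ennreal c * indicator (cball x R) y"
          proof (cases "dist x y \<le> R \<and> dist x 0 \<le> \<rho>")
            case True
            have "a x * \<kappa> x y * b y \<le> a x * (A * K * A) * A"
              using ab A_nonneg \<open>K \<ge> 0\<close>
              by (intro mult_mono mult_left_mono \<kappa>_bound) (auto simp: \<kappa>_def)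
            then show ?thesis
              using True by (simp add: inner_def c_def dist_commute ennreal_leI mult_ac)
          qed (auto simp: inner_def)
        qed
        also have "\<dots> = ennreal c * ennreal m"
          by (subst nn_integral_cmult_indicator) (simp_all add: m sets_haar_measure[OF haar])
        also have "\<dots> = ennreal (L * (a x * indicator (cball 0 \<rho>) x))"
          unfolding ennreal_mult'[OF \<open>c \<ge> 0\<close>, symmetric] by (simp add: c_def L_def mult_ac)
        also have "\<dots> = ennreal L * (ennreal (a x) * indicator (cball 0 \<rho>) x)"
          using \<open>L \<ge> 0\<close> by (simp add: ennreal_mult' indicator_def)
        finally show "(\<integral>\<^sup>+y. ennreal (a x * inner x y * b y) \<partial>\<mu>)
            \<le> ennreal L * (ennreal (a x) * indicator (cball 0 \<rho>) x)" .
      qed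
      also have "\<dots> = ennreal L * (\<integral>\<^sup>+x\<in>cball 0 \<rho>. ennreal (a x) \<partial>\<mu>)"
        by (intro nn_integral_cmult borel_measurable_times_ennreal borel_measurable_indicator)
          (simp_all add: sets_haar_measure[OF haar])
      finally show ?thesis .
    qed
    have sum: "I (\<lambda>x y. \<theta> x y + \<eta> x y) = I \<theta> + I \<eta>"
      if [measurable]: "(\<lambda>z. \<theta> (fst z) (snd z)) \<in> borel_measurable (\<mu> \<Otimes>\<^sub>M \<mu>)"
        "(\<lambda>z. \<eta> (fst z) (snd z)) \<in> borel_measurable (\<mu> \<Otimes>\<^sub>M \<mu>)"
        and "\<And>x y. 0 \<le> \<theta> x y" "\<And>x y. 0 \<le> \<eta> x y" for \<theta> \<eta>
    proof -
      have [measurable]: "\<theta> x \<in> borel_measurable \<mu>" "\<eta> x \<in> borel_measurable \<mu>" for x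
        using measurable_compose[OF measurable_Pair1'[of x \<mu> \<mu>] that(1)]
          measurable_compose[OF measurable_Pair1'[of x \<mu> \<mu>] that(2)]
        by (simp_all add: space_haar_measure[OF haar])
      have "I (\<lambda>x y. \<theta> x y + \<eta> x y)
          = (\<integral>\<^sup>+x. \<integral>\<^sup>+y. ennreal (a x * \<theta> x y * b y) + ennreal (a x * \<eta> x y * b y) \<partial>\<mu> \<partial>\<mu>)"
        unfolding I_def
        by (intro nn_integral_cong) (simp add: that(3,4) ab distrib_left distrib_right flip: ennreal_plus)
      also have "\<dots> = (\<integral>\<^sup>+x. (\<integral>\<^sup>+y. ennreal (a x * \<theta> x y * b y) \<partial>\<mu>)
          + (\<integral>\<^sup>+y. ennreal (a x * \<eta> x y * b y) \<partial>\<mu>) \<partial>\<mu>)"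
        by (intro nn_integral_cong nn_integral_add) measurable
      also have "\<dots> = I \<theta> + I \<eta>"
        unfolding I_def by (intro nn_integral_add) measurable
      finally show ?thesis .
    qed
    have "ennreal (norm (T v)) \<le> I \<kappa>"
      using kernel_bound[OF T, of v w] by (simp add: w I_def \<kappa>_def a_def b_def)
    also have "\<kappa> = (\<lambda>x y. (far x y + outer x y) + inner x y)" using split by blast
    also have "I \<dots> = I far + I outer + I inner"
      by (simp add: sum nonneg)
    also have "\<dots> \<le> ennreal (\<epsilon> * C) + ennreal (\<epsilon> * C) + ennreal L * (\<integral>\<^sup>+x\<in>cball 0 \<rho>. ennreal (a x) \<partial>\<mu>)"
      by (intro add_mono I_far I_outer I_inner)
    also have "ennreal (\<epsilon> * C) + ennreal (\<epsilon> * C) = ennreal e"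
      using C_pos \<open>0 < e\<close> by (simp add: \<epsilon>_def flip: ennreal_plus)
    finally show ?thesis unfolding a_def .
  qed
  with \<open>L \<ge> 0\<close> show ?thesis using that by blast
qed

text \<open>For a bounded sequence whose pairings converge, dominated convergence on a ball of
  finite measure makes the integral term small for differences, so the images under \<open>T\<close>
  form a Cauchy sequence. The weak limit vector is never constructed; the limit \<open>h\<close> of
  the functions \<open>cinner (v (k n)) (f x)\<close> suffices.\<close>

lemma compact_operatorI_norm_estimate:
  assumes T: "T \<in> bounded_operators"
    and estimate: "\<And>e. 0 < e \<Longrightarrow> \<exists>\<rho> L. 0 \<le> L \<and> (\<forall>v. norm v \<le> 1 \<longrightarrow>
      ennreal (norm (T v)) \<le> ennreal e + ennreal L * (\<integral>\<^sup>+x\<in>cball 0 \<rho>. ennreal (cmod (cinner v (f x))) \<partial>\<mu>))"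
  shows "compact_operator T"
proof -
  note lT = bounded_linear.linear[OF bounded_operatorsD(1)[OF T]]
  have "compact (closure (T ` cball 0 1))"
  proof (rule compact_closureI_sequence)
    fix s :: "nat \<Rightarrow> 'h" assume s: "\<And>n. s n \<in> T ` cball 0 1"
    have "\<exists>v. norm v \<le> 1 \<and> s n = T v" for n using s[of n] by auto
    then obtain v where v: "\<And>n. norm (v n) \<le> 1" and s: "\<And>n. s n = T (v n)" by metis
    have cinner_v: "cmod (cinner (v n) w) \<le> norm w" for n w
      using order_trans[OF cinner_bound mult_right_mono[OF v norm_ge_zero]] by simp
    obtain k :: "nat \<Rightarrow> nat" where "strict_mono k" and k: "\<And>w. convergent (\<lambda>n. cinner (v (k n)) w)"
    proof (rule equicontinuous_convergent_subsequence[of "\<lambda>n. cinner (v n)" norm])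
      fix w :: 'h and e :: real assume "e > 0"
      have "cmod (cinner (v n) w - cinner (v n) y) < e" if "dist w y < e" for n y
        using cinner_v[of n "w - y"] that by (simp add: cinner.diff_right dist_norm)
      then show "\<exists>d>0. \<forall>n y. dist w y < d \<longrightarrow> cmod (cinner (v n) w - cinner (v n) y) < e"
        using \<open>e > 0\<close> by blast
    qed (use cinner_v in auto)
    define h where "h x = lim (\<lambda>n. cinner (v (k n)) (f x))" for x
    have h: "(\<lambda>n. cinner (v (k n)) (f x)) \<longlonglongrightarrow> h x" for x
      using k[of "f x"] by (simp add: h_def convergent_LIMSEQ_iff)
    have [measurable]: "h \<in> borel_measurable \<mu>"
      by (rule borel_measurable_LIMSEQ_metric[OF _ h]) measurable
    have [measurable]: "cball (0::'g) r \<in> sets \<mu>" for r by (simp add: sets_haar_measure[OF haar])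
    have norm_h: "cmod (h x) \<le> A" for x
      by (intro LIMSEQ_le_const2[OF tendsto_norm[OF h]] exI allI impI order_trans[OF cinner_v norm_f])
    define J where "J \<rho> n = (\<integral>\<^sup>+x\<in>cball 0 \<rho>. ennreal (cmod (cinner (v (k n)) (f x) - h x)) \<partial>\<mu>)" for \<rho> n
    have J: "J \<rho> \<longlonglongrightarrow> 0" for \<rho>
    proof -
      have "J \<rho> \<longlonglongrightarrow> (\<integral>\<^sup>+x. 0 \<partial>\<mu>)"
        unfolding J_def
      proof (rule nn_integral_dominated_convergence[where w = "\<lambda>x. ennreal (2 * A) * indicator (cball 0 \<rho>) x"])
        show "AE x in \<mu>. ennreal (cmod (cinner (v (k n)) (f x) - h x)) * indicator (cball 0 \<rho>) x
            \<le> ennreal (2 * A) * indicator (cball 0 \<rho>) x" for n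
        proof (intro AE_I2 mult_right_mono ennreal_leI)
          fix x
          show "cmod (cinner (v (k n)) (f x) - h x) \<le> 2 * A"
            using norm_triangle_ineq4[of "cinner (v (k n)) (f x)" "h x"]
              cinner_v[of "k n" "f x"] norm_f[of x] norm_h[of x] by linarith
        qed simp
        show "(\<integral>\<^sup>+x. ennreal (2 * A) * indicator (cball 0 \<rho>) x \<partial>\<mu>) < \<infinity>"
          using emeasure_cball_finite[of 0 \<rho>]
          by (subst nn_integral_cmult_indicator) (simp_all add: ennreal_mult_less_top)
        show "AE x in \<mu>. (\<lambda>n. ennreal (cmod (cinner (v (k n)) (f x) - h x)) * indicator (cball 0 \<rho>) x) \<longlonglongrightarrow> 0"
        proof (rule AE_I2)
          fix x
          have "(\<lambda>n. cmod (cinner (v (k n)) (f x) - h x)) \<longlonglongrightarrow> 0"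
            by (intro tendsto_norm_zero LIM_zero h)
          then have lim: "(\<lambda>n. ennreal (cmod (cinner (v (k n)) (f x) - h x))) \<longlonglongrightarrow> 0"
            using tendsto_ennrealI by fastforce
          then show "(\<lambda>n. ennreal (cmod (cinner (v (k n)) (f x) - h x)) * indicator (cball 0 \<rho>) x) \<longlonglongrightarrow> 0"
            by (cases "x \<in> cball 0 \<rho>") (simp_all del: mem_cball)
        qed
      qed measurable
      then show ?thesis by simp
    qed
    have "Cauchy (\<lambda>n. T (v (k n)))"
    proof (rule CauchyI)
      fix e :: real assume "e > 0"
      then obtain \<rho> L where "0 \<le> L" and L: "\<And>v. norm v \<le> 1 \<Longrightarrow>
          ennreal (norm (T v)) \<le> ennreal (e / 8) + ennreal L * (\<integral>\<^sup>+x\<in>cball 0 \<rho>. ennreal (cmod (cinner v (f x))) \<partial>\<mu>)"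
        using estimate[of "e / 8"] by auto
      \<comment> \<open>Then \<open>L * (d + d) \<le> e / 4\<close>, and doubling
        \<open>e / 8 + e / 4\<close> stays below \<open>e\<close>.\<close>
      define d where "d = e / (8 * (L + 1))"
      have "d > 0" using \<open>e > 0\<close> \<open>0 \<le> L\<close> by (simp add: d_def)
      have "L * (d + d) \<le> (L + 1) * (d + d)" using \<open>d > 0\<close> by (intro mult_right_mono) auto
      also have "\<dots> = 2 * ((L + 1) * d)" by (simp add: algebra_simps)
      also have "(L + 1) * d = e / 8" using \<open>0 \<le> L\<close> by (simp add: d_def field_simps)
      finally have Ld: "L * (d + d) \<le> e / 4" by simp
      have "\<forall>\<^sub>F n in sequentially. J \<rho> n < ennreal d"
        using \<open>d > 0\<close> by (intro order_tendstoD(2)[OF J]) simp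
      then obtain N where N: "\<And>n. n \<ge> N \<Longrightarrow> J \<rho> n < ennreal d" by (auto simp: eventually_sequentially)
      have "norm (T (v (k i)) - T (v (k j))) < e" if "i \<ge> N" "j \<ge> N" for i j
      proof -
        \<comment> \<open>The factor 1/2 returns the difference to the unit ball, where the estimate
          is available.\<close>
        define u where "u = (1/2) *\<^sub>R (v (k i) - v (k j))"
        have "norm u \<le> 1"
          using norm_triangle_ineq4[of "v (k i)" "v (k j)"] v[of "k i"] v[of "k j"] by (simp add: u_def)
        have "(\<integral>\<^sup>+x\<in>cball 0 \<rho>. ennreal (cmod (cinner u (f x))) \<partial>\<mu>)
            \<le> (\<integral>\<^sup>+x. ennreal (cmod (cinner (v (k i)) (f x) - h x)) * indicator (cball 0 \<rho>) x
                + ennreal (cmod (cinner (v (k j)) (f x) - h x)) * indicator (cball 0 \<rho>) x \<partial>\<mu>)"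
        proof (rule nn_integral_mono)
          fix x
          have "cmod (cinner u (f x)) \<le> cmod (cinner (v (k i)) (f x) - cinner (v (k j)) (f x))"
            by (simp add: u_def cinner_scaleR_left cinner.diff_left)
          also have "\<dots> \<le> cmod (cinner (v (k i)) (f x) - h x) + cmod (cinner (v (k j)) (f x) - h x)"
            using norm_triangle_ineq4[of "cinner (v (k i)) (f x) - h x" "cinner (v (k j)) (f x) - h x"] by simp
          finally show "ennreal (cmod (cinner u (f x))) * indicator (cball 0 \<rho>) x
              \<le> ennreal (cmod (cinner (v (k i)) (f x) - h x)) * indicator (cball 0 \<rho>) x
                + ennreal (cmod (cinner (v (k j)) (f x) - h x)) * indicator (cball 0 \<rho>) x"
            by (simp add: indicator_def ennreal_leI flip: ennreal_plus)
        qed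
        also have "\<dots> = J \<rho> i + J \<rho> j"
          unfolding J_def by (rule nn_integral_add) measurable
        also have "\<dots> \<le> ennreal d + ennreal d"
          using N[OF that(1)] N[OF that(2)] by (intro add_mono) auto
        also have "\<dots> = ennreal (d + d)" using \<open>d > 0\<close> by (intro ennreal_plus[symmetric]) simp_all
        finally have small: "(\<integral>\<^sup>+x\<in>cball 0 \<rho>. ennreal (cmod (cinner u (f x))) \<partial>\<mu>) \<le> ennreal (d + d)" .
        have "ennreal (norm (T u)) \<le> ennreal (e / 8) + ennreal L * ennreal (d + d)"
          by (rule order_trans[OF L[OF \<open>norm u \<le> 1\<close>]]) (intro add_left_mono mult_left_mono small, simp)
        also have "\<dots> \<le> ennreal (e / 8) + ennreal (e / 4)"
          unfolding ennreal_mult'[OF \<open>0 \<le> L\<close>, symmetric] by (intro add_left_mono ennreal_leI Ld)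
        also have "\<dots> = ennreal (e / 8 + e / 4)" using \<open>e > 0\<close> by (intro ennreal_plus[symmetric]) auto
        finally have "norm (T u) \<le> e / 8 + e / 4" using \<open>e > 0\<close> by (simp add: ennreal_le_iff)
        moreover have "norm (T (v (k i)) - T (v (k j))) = 2 * norm (T u)"
          by (simp add: u_def linear_scale[OF lT] linear_diff[OF lT])
        ultimately show ?thesis using \<open>e > 0\<close> by linarith
      qed
      then show "\<exists>M. \<forall>i\<ge>M. \<forall>j\<ge>M. norm (T (v (k i)) - T (v (k j))) < e" by blast
    qed
    then obtain l where "(\<lambda>n. T (v (k n))) \<longlonglongrightarrow> l" using Cauchy_convergent convergentD by blast
    then show "\<exists>k l. strict_mono k \<and> (s \<circ> k) \<longlonglongrightarrow> l"
      using \<open>strict_mono k\<close> by (auto simp: o_def s)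
  qed
  with T show ?thesis by (simp add: compact_operator_def)
qed

end

theorem theorem5p1:
  fixes \<mu> :: "'g::{topological_group_add, metric_space, second_countable_topology} measure"
    and f :: "'g \<Rightarrow> 'h::{chilbert_space, second_countable_topology}"
    and T :: "'h \<Rightarrow> 'h"
    and p :: "'g \<Rightarrow> real"
  assumes "locally_compact_space (euclidean :: 'g topology)"
    and "left_invariant_metric TYPE('g)"
    and "proper_metric TYPE('g)"
    and "geodesic_metric TYPE('g)"
    and "finite_asymptotic_dimension TYPE('g)"
    and "left_haar_measure \<mu>"
    and "continuous_frame \<mu> f"
    and "\<And>x y z. cinner (canonical_dual \<mu> f x) (f y) =
           cinner (canonical_dual \<mu> f (z + x)) (f (z + y))"
    and "inj_on (berezin \<mu> f) bounded_operators"
    and "T \<in> bounded_operators"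
    and "p \<in> borel_measurable borel" and "\<And>x. p x > 0"
    and "weakly_localized \<mu> p (canonical_dual \<mu> f) f T"
  shows "compact_operator T \<longleftrightarrow>
    (berezin \<mu> f T \<longlongrightarrow> 0) (filtercomap (\<lambda>x. dist x 0) at_top)"
proof -
  define g where "g = canonical_dual \<mu> f"
  obtain A C where "dual_frames \<mu> f g A C"
    using continuous_frame_dual_frames[OF assms(6,2,3,7,8)] unfolding g_def by blast
  then interpret dual_frames \<mu> f g A C .
  have berezin: "berezin \<mu> f T' = (\<lambda>x. cinner (T' (g x)) (f x))" for T'
    by (simp add: fun_eq_iff berezin_def g_def)
  show ?thesis
  proof
    assume "compact_operator T"
    then show "(berezin \<mu> f T \<longlongrightarrow> 0) (filtercomap (\<lambda>x. dist x 0) at_top)"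
      unfolding berezin by (rule compact_operator_imp_berezin_vanishes)
  next
    assume vanish: "(berezin \<mu> f T \<longlongrightarrow> 0) (filtercomap (\<lambda>x. dist x 0) at_top)"
    \<comment> \<open>Injectivity of the Berezin transform is applied to \<open>T'\<close> and the
      zero operator.\<close>
    have "T' = (\<lambda>_. 0)" if "T' \<in> bounded_operators" "\<And>x. cinner (T' (g x)) (f x) = 0" for T'
    proof (rule inj_onD[OF assms(9)])
      show "berezin \<mu> f T' = berezin \<mu> f (\<lambda>_. 0)"
        unfolding berezin using that(2) by (simp add: cinner.zero_left)
      have "c *\<^sub>C (0 :: 'h) = 0" for c by (metis mult_zero_right norm_eq_zero norm_scaleC)
      then show "(\<lambda>_. 0 :: 'h) \<in> bounded_operators"
        by (simp add: bounded_operators_def)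
    qed (fact that(1))
    then have decay: "\<exists>\<rho>. \<forall>x y. dist x 0 > \<rho> \<longrightarrow> dist x y \<le> R \<longrightarrow> cmod (cinner (T (g x)) (f y)) < \<delta>"
      if "0 < \<delta>" for \<delta> R
      using kernel_vanishes_at_infinity[OF assms(10) _ vanish[unfolded berezin] that] by metis
    show "compact_operator T"
    proof (rule compact_operatorI_norm_estimate[OF assms(10)])
      fix e :: real assume "0 < e"
      then show "\<exists>\<rho> L. 0 \<le> L \<and> (\<forall>v. norm v \<le> 1 \<longrightarrow> ennreal (norm (T v))
          \<le> ennreal e + ennreal L * (\<integral>\<^sup>+x\<in>cball 0 \<rho>. ennreal (cmod (cinner v (f x))) \<partial>\<mu>))"
        using norm_estimate[OF assms(10,11,12) assms(13)[folded g_def] decay] by metis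
    qed
  qed
qed

end
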